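(* Let $N>\zeta$ and $M$ be positive integers, where $\zeta$ is the upper bound on the number of support constraints described in the context, and let $\beta^*\in(0,1)$ be prescribed. Consider all admissible functions $\epsilon:\{0,\dots,\zeta\}\times\{0,\dots,M\}\to[0,1]$, i.e. those satisfying: (i) the probabilistic guarantee $$\mathbb{P}^{N+M}\left\{V(\mathbf{x}_N^* )>\epsilon(s_N^*,r_M^* )\right\}\le\beta^*$$ with the prescribed $\beta^*$, in a distribution-free manner, that is, for every convex scenario program in the class described in the context (any such problem and any probability measure $\mathbb{P}$); and (ii) the monotonicity property $\epsilon(k,l)<\epsilon(k,l+1)$ for all $k\in\{0,\dots,\zeta\}$ and $l\in\{0,\dots,M-1\}$. Then, for $1\le k\le\zeta$ and $0\le l\le M$, a lower limit $\underline{\epsilon}(k,l)$ of $\epsilon(k,l)$ (that is, a value such that $\epsilon(k,l)\ge\underline{\epsilon}(k,l)$ for every admissible function) is given by the root in $(0,1)$ of the following equation in the unknown $\epsilon$: $$\sum_{j=0}^l z_j\,B_{N+M}(\epsilon;k+j-1)=\beta^*,\qquad\text{where}\quad z_j=\frac{\binom{N}{k}\binom{M}{j}}{\binom{N+M}{k+j}}\cdot\frac{k}{k+j}.$$ For $k=0$, the lower limit is $\underline{\epsilon}(0,l)=0$ for all $l\in\{0,\dots,M\}$.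
   Context: For a positive integer $n$, a non-negative integer $m\le n$ and $t\in(0,1)$, $B_n(t;m)=\sum_{i=0}^m\binom{n}{i}t^i(1-t)^{n-i}$. Class of scenario programs. $(\Delta,\mathcal{F},\mathbb{P})$ is a probability space; $(\Delta^m,\mathcal{F}^m,\mathbb{P}^m)$ is its $m$-fold product. $\mathcal{X}\subseteq\mathbb{R}^d$ is convex and closed, $J:\mathbb{R}^d\to\mathbb{R}$ is convex, and $f(\mathbf{x},\delta)$ is lower semi-continuous and convex in $\mathbf{x}\in\mathbb{R}^d$ for each fixed $\delta\in\Delta$. For $\omega_m=\{\delta^{(1)},\dots,\delta^{(m)}\}\in\Delta^m$, the scenario program $\mathrm{SP}_m[\omega_m]$ is: minimize $J(\mathbf{x})$ over $\mathbf{x}\in\mathcal{X}$ subject to $f(\mathbf{x},\delta^{(i)})\le0$ for $i=1,\dots,m$ (for $m=0$ there are no scenario constraints). Violation probability: $V(\mathbf{x})=\mathbb{P}\{\delta\in\Delta: f(\mathbf{x},\delta)>0\}$. A support constraint of $\mathrm{SP}_m[\omega_m]$ is a constraint whose removal yields a different optimal solution; $s_m^*$ is the number of support constraints. The programs in the class satisfy: - Feasibility and Uniqueness: for every $m\ge0$ and every $\omega_m\in\Delta^m$, the optimal solution $\mathbf{x}_m^*$ of $\mathrm{SP}_m[\omega_m]$ exists and is unique (and $V(\mathbf{x}_m^* )$ is measurable); - Non-Degeneracy: with probability one the solution of $\mathrm{SP}_m[\omega_m]$ coincides with the solution of the program defined by its support constraints only; - the number of support constraints is at most $\zeta$ ($\zeta\le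 d$ is Helly's dimension or a tighter bound). The scenarios $\delta^{(1)},\dots,\delta^{(N)},\tilde\delta^{(1)},\dots,\tilde\delta^{(M)}$ are drawn from $\mathbb{P}^{N+M}$; $\mathbf{x}_N^*$ and $s_N^*$ refer to the program $\mathrm{SP}_N$ built from $\delta^{(1)},\dots,\delta^{(N)}$; $r_M^*=\sum_{i=1}^M\mathbf{1}_{\{\delta: f(\mathbf{x}_N^*,\delta)>0\}}(\tilde\delta^{(i)})$ is the number of validation scenarios violated by $\mathbf{x}_N^*$.
   Formalization: The root in (0,1) need not exist (e.g. N=2, M=1, k=1, l=0, β*=0.9, where z_0=2/3); what is proved is that it exists exactly when β* < z_0+…+z_l, is then unique, and is a lower limit whenever it exists. *)

theory Defs
  imports "HOL-Probability.Probability" "HOL-Library.Equipollence"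
begin

definition lower_semicontinuous :: "('x::topological_space \<Rightarrow> real) \<Rightarrow> bool" where
  "lower_semicontinuous g \<longleftrightarrow> (\<forall>x. \<forall>c. c < g x \<longrightarrow> (\<forall>\<^sub>F y in nhds x. c < g y))"

definition binom_tail :: "nat \<Rightarrow> real \<Rightarrow> nat \<Rightarrow> real" where
  "binom_tail n t m = (\<Sum>i\<le>m. real (n choose i) * t ^ i * (1 - t) ^ (n - i))"

text \<open>
  A multi-scenario is a function \<open>\<omega> :: nat \<Rightarrow> 's\<close>, and a scenario program is determined by the
  finite set \<open>I\<close> of indices whose scenarios are enforced: the program with \<open>m\<close> scenarios has
  \<open>I = {..<m}\<close>, and removing constraint \<open>i\<close> means passing to \<open>I - {i}\<close>. Constraints are counted
  by index, so repeated scenarios count as separate constraints.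
\<close>

definition feasible ::
  "'x set \<Rightarrow> ('x \<Rightarrow> 's \<Rightarrow> real) \<Rightarrow> (nat \<Rightarrow> 's) \<Rightarrow> nat set \<Rightarrow> 'x \<Rightarrow> bool" where
  "feasible X f \<omega> I x \<longleftrightarrow> x \<in> X \<and> (\<forall>i\<in>I. f x (\<omega> i) \<le> 0)"

definition solution ::
  "'x set \<Rightarrow> ('x \<Rightarrow> real) \<Rightarrow> ('x \<Rightarrow> 's \<Rightarrow> real) \<Rightarrow> (nat \<Rightarrow> 's) \<Rightarrow> nat set \<Rightarrow> 'x" where
  "solution X J f \<omega> I = arg_min J (feasible X f \<omega> I)"

definition support_constraints ::
  "'x set \<Rightarrow> ('x \<Rightarrow> real) \<Rightarrow> ('x \<Rightarrow> 's \<Rightarrow> real) \<Rightarrow> (nat \<Rightarrow> 's) \<Rightarrow> nat \<Rightarrow> nat set" where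
  "support_constraints X J f \<omega> m =
     {i \<in> {..<m}. solution X J f \<omega> ({..<m} - {i}) \<noteq> solution X J f \<omega> {..<m}}"

definition violation_prob :: "'s measure \<Rightarrow> ('x \<Rightarrow> 's \<Rightarrow> real) \<Rightarrow> 'x \<Rightarrow> real" where
  "violation_prob P f x = measure P {\<delta> \<in> space P. f x \<delta> > 0}"

text \<open>
  The first \<open>N\<close> coordinates of \<open>\<omega>\<close> are the design scenarios; coordinates \<open>N, \<dots>, N + M - 1\<close> are
  the validation scenarios.
\<close>

definition validation_violations ::
  "'x set \<Rightarrow> ('x \<Rightarrow> real) \<Rightarrow> ('x \<Rightarrow> 's \<Rightarrow> real) \<Rightarrow> nat \<Rightarrow> nat \<Rightarrow> (nat \<Rightarrow> 's) \<Rightarrow> nat" where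
  "validation_violations X J f N M \<omega> =
     (\<Sum>i<M. indicator {\<delta>. f (solution X J f \<omega> {..<N}) \<delta> > 0} (\<omega> (N + i)))"

locale scenario_program = prob_space P
  for P :: "'s measure" +
  fixes X :: "(real ^ 'n::finite) set"
    and J :: "real ^ 'n \<Rightarrow> real"
    and f :: "real ^ 'n \<Rightarrow> 's \<Rightarrow> real"
    and \<zeta> :: nat
  assumes convex_X: "convex X"
    and closed_X: "closed X"
    and convex_J: "convex_on UNIV J"
    and convex_f: "\<And>\<delta>. \<delta> \<in> space P \<Longrightarrow> convex_on UNIV (\<lambda>x. f x \<delta>)"
    and lsc_f: "\<And>\<delta>. \<delta> \<in> space P \<Longrightarrow> lower_semicontinuous (\<lambda>x. f x \<delta>)"
    and measurable_f: "\<And>x. f x \<in> borel_measurable P"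
    and feasibility_uniqueness:
      "\<And>m \<omega>. \<omega> \<in> space (PiM {..<m} (\<lambda>_. P)) \<Longrightarrow>
         \<exists>!x. is_arg_min J (feasible X f \<omega> {..<m}) x"
    and measurable_violation:
      "\<And>m. (\<lambda>\<omega>. violation_prob P f (solution X J f \<omega> {..<m}))
         \<in> borel_measurable (PiM {..<m} (\<lambda>_. P))"
    and nondegeneracy:
      "\<And>m. AE \<omega> in PiM {..<m} (\<lambda>_. P).
         solution X J f \<omega> {..<m} = solution X J f \<omega> (support_constraints X J f \<omega> m)"
    and support_bound:
      "\<And>m \<omega>. \<omega> \<in> space (PiM {..<m} (\<lambda>_. P)) \<Longrightarrow>
         card (support_constraints X J f \<omega> m) \<le> \<zeta>"

text \<open>
  The two type arguments fix the dimension \<open>d = CARD('n)\<close> and the type \<open>'s\<close> whose elements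
  serve as scenarios; the probability space \<open>P\<close> (carrier set, sigma-algebra and measure) and
  the program data range over all possibilities on these types. No generality is lost once
  \<open>'s\<close> has at least the cardinality of the reals: a program depends on \<open>\<delta>\<close> only through the
  convex function \<open>\<lambda>x. f x \<delta>\<close> on \<open>d\<close>-space, and there are only continuum many of these, so any
  scenario space can be pushed forward to one on \<open>'s\<close>. The event below is always
  measurable for a program in the class: \<open>f\<close> is real-valued and convex, hence continuous, in \<open>x\<close>
  and measurable in \<open>\<delta>\<close>.
\<close>

definition admissible ::
  "'n::finite itself \<Rightarrow> 's itself \<Rightarrow> nat \<Rightarrow> nat \<Rightarrow> nat \<Rightarrow> real \<Rightarrow> (nat \<Rightarrow> nat \<Rightarrow> real) \<Rightarrow> bool" where
  "admissible (_ :: 'n itself) (_ :: 's itself) \<zeta> N M \<beta> \<epsilon> \<longleftrightarrow>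
     (\<forall>k\<in>{0..\<zeta>}. \<forall>l\<in>{0..M}. \<epsilon> k l \<in> {0..1}) \<and>
     (\<forall>(P :: 's measure) (X :: (real ^ 'n) set) J f.
        scenario_program P X J f \<zeta> \<longrightarrow>
        measure (PiM {..<N + M} (\<lambda>_. P))
          {\<omega> \<in> space (PiM {..<N + M} (\<lambda>_. P)).
             violation_prob P f (solution X J f \<omega> {..<N})
               > \<epsilon> (card (support_constraints X J f \<omega> N)) (validation_violations X J f N M \<omega>)}
          \<le> \<beta>) \<and>
     (\<forall>k\<in>{0..\<zeta>}. \<forall>l<M. \<epsilon> k l < \<epsilon> k (Suc l))"

definition is_lower_limit ::
  "'n::finite itself \<Rightarrow> 's itself \<Rightarrow> nat \<Rightarrow> nat \<Rightarrow> nat \<Rightarrow> real \<Rightarrow> nat \<Rightarrow> nat \<Rightarrow> real \<Rightarrow> bool" where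
  "is_lower_limit TN TS \<zeta> N M \<beta> k l e \<longleftrightarrow>
     (\<forall>\<epsilon>. admissible TN TS \<zeta> N M \<beta> \<epsilon> \<longrightarrow> \<epsilon> k l \<ge> e)"

definition zcoef :: "nat \<Rightarrow> nat \<Rightarrow> nat \<Rightarrow> nat \<Rightarrow> real" where
  "zcoef N M k j =
     real (N choose k) * real (M choose j) / real ((N + M) choose (k + j)) * (real k / real (k + j))"

text \<open>
  The left-hand side equals \<open>\<Sum>j\<le>l. zcoef N M k j\<close> at 0 and vanishes at 1, so a root in the open
  unit interval exists only if that sum exceeds \<open>\<beta>\<close>; for small \<open>l\<close> it need not.
\<close>

definition is_limit_root :: "nat \<Rightarrow> nat \<Rightarrow> real \<Rightarrow> nat \<Rightarrow> nat \<Rightarrow> real \<Rightarrow> bool" where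
  "is_limit_root N M \<beta> k l e \<longleftrightarrow>
     0 < e \<and> e < 1 \<and> (\<Sum>j = 0..l. zcoef N M k j * binom_tail (N + M) e (k + j - 1)) = \<beta>"

end

theory Submission
  imports Defs
begin

text \<open>
  The bound is attained, for each \<open>k\<close>, by a program in which almost surely exactly \<open>k\<close> scenarios
  are support constraints. A scenario is reduced to an atomless number \<open>u\<close> in the open unit interval. The
  program selects scenarios in \<open>k\<close> stages: stage \<open>j\<close> selects the maximizer of a polynomial score,
  and the next score is \<open>s * (y - s)\<close>, where \<open>y\<close> is the maximum of the current score \<open>s\<close>; hence
  selected scenarios have score \<open>0\<close> in all later stages and are never selected again. These are the
  optimality conditions of a triangular convex program: in the variables \<open>exp x\<close> stage \<open>j\<close> reads
  \<open>base + score \<le> exp x\<^sub>j\<close>, where \<open>base\<close> depends on the earlier variables only and makes all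
  coefficients nonnegative, as in geometric programming.

  Almost surely exactly one \<open>k\<close>-subset of \<open>n\<close> scenarios has an optimum that no other scenario
  violates. By exchangeability the violation probability \<open>V\<close> of a \<open>k\<close>-scenario optimum therefore satisfies
  \<open>(n choose k) * E (1 - V) ^ (n - k) = 1\<close> for all \<open>n\<close>; these moments determine its law, with
  density \<open>k * v ^ (k - 1)\<close>. Integrating over this law shows that \<open>V > a\<close> together with at most
  \<open>l\<close> violated validation scenarios has probability \<open>\<Sum>j\<le>l. z\<^sub>j B\<^sub>N\<^sub>+\<^sub>M(a; k + j - 1)\<close>,
  and by monotonicity of \<open>\<epsilon>\<close> this event is bad for \<open>a = \<epsilon> k l\<close>.
\<close>

section \<open>Stagewise selection\<close>

text \<open>The inserted \<open>0\<close> keeps the maximum defined and nonnegative for empty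
  \<open>W\<close>, which covers the program without scenarios.\<close>

definition peak :: "real set \<Rightarrow> (real \<Rightarrow> real) \<Rightarrow> real" where
  "peak W g = Max (insert 0 (g ` W))"

primrec score :: "real set \<Rightarrow> nat \<Rightarrow> real \<Rightarrow> real" where
  "score W 0 u = u"
| "score W (Suc j) u = score W j u * (peak W (score W j) - score W j u)"

definition level :: "real set \<Rightarrow> nat \<Rightarrow> real" where
  "level W j = peak W (score W j)"

lemma score_Suc: "score W (Suc j) u = score W j u * (level W j - score W j u)"
  by (simp add: level_def)

declare score.simps(2) [simp del]

lemma peak_nonneg: "finite W \<Longrightarrow> 0 \<le> peak W g"
  by (simp add: peak_def)

lemma le_peak: "finite W \<Longrightarrow> u \<in> W \<Longrightarrow> g u \<le> peak W g"
  by (simp add: peak_def)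

lemma peak_attained: "finite W \<Longrightarrow> 0 < peak W g \<Longrightarrow> \<exists>u\<in>W. g u = peak W g"
  using Max_in[of "insert 0 (g ` W)"] unfolding peak_def by auto

lemma peak_le_iff: "finite W \<Longrightarrow> peak W g \<le> c \<longleftrightarrow> 0 \<le> c \<and> (\<forall>u\<in>W. g u \<le> c)"
  by (auto simp: peak_def)

lemma peak_mono: "finite W \<Longrightarrow> W' \<subseteq> W \<Longrightarrow> peak W' g \<le> peak W g"
  unfolding peak_def by (rule Max_mono) auto

lemma level_nonneg: "finite W \<Longrightarrow> 0 \<le> level W j"
  by (simp add: level_def peak_nonneg)

lemma score_le_level: "finite W \<Longrightarrow> u \<in> W \<Longrightarrow> score W j u \<le> level W j"
  by (simp add: level_def le_peak)

lemma level_attained: "finite W \<Longrightarrow> 0 < level W j \<Longrightarrow> \<exists>u\<in>W. score W j u = level W j"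
  by (simp add: level_def peak_attained)

section \<open>Levels and selected scenarios under a change of the scenario set\<close>

lemma score_cong_levels:
  assumes "\<And>i. i < j \<Longrightarrow> level W i = level W' i"
  shows "score W j = score W' j"
  using assms by (induction j) (auto simp: score_Suc fun_eq_iff)

text \<open>Induction on the stage: equal earlier levels give the same score function, and one
  surviving maximizer bounds the smaller maximum from below. A stage of level \<open>0\<close> needs
  no survivor, since a peak is never below \<open>0\<close>.\<close>

lemma levels_eq_subset:
  assumes fin: "finite W" and sub: "W' \<subseteq> W"
    and att: "\<And>j. j < n \<Longrightarrow> 0 < level W j \<Longrightarrow> \<exists>u\<in>W'. score W j u = level W j"
  shows "j < n \<Longrightarrow> level W' j = level W j"
proof (induction j rule: less_induct)
  case (less j)
  have fin': "finite W'" using fin sub finite_subset by blast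
  have sc: "score W' j = score W j"
    using less by (intro score_cong_levels) auto
  have "level W' j \<le> level W j"
    unfolding level_def sc using fin sub by (rule peak_mono)
  moreover have "level W j \<le> level W' j"
  proof (cases "0 < level W j")
    case True
    then obtain u where "u \<in> W'" "score W j u = level W j"
      using att less.prems by blast
    then show ?thesis using score_le_level[OF fin', of u j] sc by simp
  next
    case False
    then show ?thesis using level_nonneg[OF fin', of j] by simp
  qed
  ultimately show ?case by simp
qed

text \<open>This is the violation of scenario \<open>u\<close> by the optimum for the scenarios \<open>W\<close>.\<close>

definition exceeds :: "nat \<Rightarrow> real set \<Rightarrow> real \<Rightarrow> bool" where
  "exceeds k W u \<longleftrightarrow> (\<exists>j<k. level W j < score W j u)"

text \<open>As long as the earlier levels agree, both sets share the score function, so a scenario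
  that does not violate the optimum of \<open>W'\<close> cannot raise the current maximum.\<close>

lemma levels_eq_not_exceeds:
  assumes fin: "finite W" and sub: "W' \<subseteq> W"
    and nex: "\<And>u. u \<in> W - W' \<Longrightarrow> \<not> exceeds k W' u"
  shows "j < k \<Longrightarrow> level W' j = level W j"
proof (induction j rule: less_induct)
  case (less j)
  have fin': "finite W'" using fin sub finite_subset by blast
  have sc: "score W' j = score W j"
    using less by (intro score_cong_levels) auto
  have "level W' j \<le> level W j"
    unfolding level_def sc using fin sub by (rule peak_mono)
  moreover have "score W' j u \<le> level W' j" if "u \<in> W" for u
    using that nex[of u] less.prems score_le_level[OF fin', of u j]
    unfolding exceeds_def by (cases "u \<in> W'") force+
  then have "level W j \<le> level W' j"
    unfolding level_def[of W] sc[symmetric] peak_le_iff[OF fin]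
    using level_nonneg[OF fin', of j] by auto
  ultimately show ?case by simp
qed

lemma exceeds_cong:
  assumes "\<And>j. j < k \<Longrightarrow> level W j = level W' j"
  shows "exceeds k W u \<longleftrightarrow> exceeds k W' u"
proof -
  have "score W j = score W' j" if "j < k" for j
    using assms that by (intro score_cong_levels) auto
  then show ?thesis unfolding exceeds_def using assms by auto
qed

text \<open>Ties at \<open>0\<close> have to be allowed, because every scenario already selected has
  score \<open>0\<close> in all later stages.\<close>

definition tie_free :: "real set \<Rightarrow> bool" where
  "tie_free W \<longleftrightarrow>
     (\<forall>j. \<forall>u\<in>W. \<forall>v\<in>W. u \<noteq> v \<longrightarrow> score W j u = score W j v \<longrightarrow> score W j u = 0)"

text \<open>A stage of level \<open>0\<close> selects nothing: the condition
  \<open>0 < level W j\<close> excludes earlier selections, whose score \<open>0\<close> would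
  attain that level.\<close>

definition picks :: "nat \<Rightarrow> real set \<Rightarrow> real set" where
  "picks k W = {u\<in>W. \<exists>j<k. score W j u = level W j \<and> 0 < level W j}"

lemma picks_subset: "picks k W \<subseteq> W"
  by (auto simp: picks_def)

lemma score_eq_0_mono:
  assumes "score W i u = 0" "i \<le> j"
  shows "score W j u = 0"
  using assms(2)
proof (induction j rule: dec_induct)
  case base
  show ?case by (fact assms(1))
next
  case (step n)
  then show ?case by (simp add: score_Suc)
qed

lemma score_eq_0_after:
  assumes "score W i u = level W i" "i < j"
  shows "score W j u = 0"
proof (rule score_eq_0_mono)
  show "score W (Suc i) u = 0" by (simp add: score_Suc assms(1))
qed (use assms(2) in simp)

text \<open>Every positive level is attained at a selected scenario, so the selection alone
  reproduces all levels. This becomes the non-degeneracy of the program.\<close>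

lemma levels_picks:
  assumes "finite W" "picks k W \<subseteq> W'" "W' \<subseteq> W" "j < k"
  shows "level W' j = level W j"
proof (rule levels_eq_subset[OF assms(1,3) _ assms(4)])
  fix j assume "j < k" "0 < level W j"
  then show "\<exists>u\<in>W'. score W j u = level W j"
    using level_attained[OF assms(1), of j] assms(2) unfolding picks_def by blast
qed

lemma pick_unique:
  assumes "tie_free W" "u \<in> W" "v \<in> W"
    "score W j u = level W j" "score W j v = level W j" "0 < level W j"
  shows "u = v"
proof (rule ccontr)
  assume "u \<noteq> v"
  then have "score W j u = 0" using assms unfolding tie_free_def by metis
  then show False using assms by simp
qed

text \<open>If all levels survived, some element of \<open>W'\<close> would attain the level of the
  stage that selects \<open>u\<close>, but without ties \<open>u\<close> is the only maximizer
  there. Hence selected scenarios are support constraints.\<close>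

lemma levels_neq_without_pick:
  assumes fin: "finite W" and tf: "tie_free W" and u: "u \<in> picks k W"
    and sub: "W' \<subseteq> W" "u \<notin> W'"
  shows "\<exists>j<k. level W' j \<noteq> level W j"
proof (rule ccontr)
  assume "\<not> ?thesis"
  then have eq: "\<And>j. j < k \<Longrightarrow> level W' j = level W j" by blast
  have fin': "finite W'" using fin sub finite_subset by blast
  obtain j where j: "j < k" "score W j u = level W j" "0 < level W j" "u \<in> W"
    using u unfolding picks_def by auto
  have sc: "score W' j = score W j"
    using eq j(1) by (intro score_cong_levels) auto
  obtain v where "v \<in> W'" "score W' j v = level W' j"
    using level_attained[OF fin', of j] eq[OF j(1)] j(3) by auto
  then have "v = u"
    using pick_unique[OF tf, of v u j] j sub(1) sc eq[OF j(1)] by auto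
  with \<open>v \<in> W'\<close> sub(2) show False by simp
qed

lemma card_picks_le:
  assumes fin: "finite W" and tf: "tie_free W"
  shows "card (picks k W) \<le> k"
proof -
  let ?f = "\<lambda>j. SOME u. u \<in> W \<and> score W j u = level W j"
  have "u \<in> ?f ` {..<k}" if u: "u \<in> picks k W" for u
  proof -
    obtain j where j: "j < k" "score W j u = level W j" "0 < level W j" "u \<in> W"
      using u unfolding picks_def by auto
    have "?f j \<in> W \<and> score W j (?f j) = level W j"
      by (rule someI[of _ u]) (use j in auto)
    then have "u = ?f j" using pick_unique[OF tf] j by blast
    then show ?thesis using j(1) by blast
  qed
  then have "picks k W \<subseteq> ?f ` {..<k}" by blast
  then have "card (picks k W) \<le> card (?f ` {..<k})" by (intro card_mono) auto
  also have "\<dots> \<le> k" using card_image_le[of "{..<k}" ?f] by simp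
  finally show ?thesis .
qed

text \<open>At most \<open>j\<close> scenarios are selected before stage \<open>j\<close>, so some
  \<open>u\<close> is left over. At each earlier stage its score lies strictly between
  \<open>0\<close> and the level, which keeps the product \<open>s * (y - s)\<close>
  positive.\<close>

lemma level_pos:
  assumes fin: "finite W" and pos: "\<forall>u\<in>W. 0 < u" and tf: "tie_free W" and j: "j < card W"
  shows "0 < level W j"
proof -
  have "card (picks j W) < card W" using card_picks_le[OF fin tf, of j] j by simp
  then obtain u where u: "u \<in> W" "u \<notin> picks j W"
    using picks_subset[of j W] by (metis nat_neq_iff subsetI subset_antisym)
  have "0 < score W j' u" if "j' \<le> j" for j' using that
  proof (induction j')
    case 0
    then show ?case using pos u by simp
  next
    case (Suc i)
    have "score W i u \<noteq> level W i"
      using Suc u unfolding picks_def by auto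
    then show ?case
      using Suc score_le_level[OF fin u(1), of i] by (simp add: score_Suc less_le)
  qed
  then show ?thesis using score_le_level[OF fin u(1), of j] by (meson le_refl less_le_trans)
qed

lemma card_picks:
  assumes fin: "finite W" and pos: "\<forall>u\<in>W. 0 < u" and tf: "tie_free W" and k: "k \<le> card W"
  shows "card (picks k W) = k"
proof -
  have lp: "0 < level W j" if "j < k" for j
    using level_pos[OF fin pos tf] that k by simp
  have "\<forall>j\<in>{..<k}. \<exists>u. u \<in> W \<and> score W j u = level W j"
    using level_attained[OF fin lp] by blast
  then obtain p where p: "\<And>j. j < k \<Longrightarrow> p j \<in> W \<and> score W j (p j) = level W j"
    by (metis lessThan_iff)
  \<comment> \<open>A scenario selected at stage \<open>i\<close> has score \<open>0\<close> at any
    later stage \<open>j\<close>, where the maximizer has a positive score.\<close>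
  have "inj_on p {..<k}"
  proof (rule linorder_inj_onI)
    fix i j assume ij: "i < j" "i \<in> {..<k}" "j \<in> {..<k}"
    have "score W j (p i) = 0" using score_eq_0_after[of W i "p i" j] p[of i] ij by simp
    moreover have "score W j (p j) > 0" using p[of j] lp[of j] ij by simp
    ultimately show "p i \<noteq> p j" by auto
  qed auto
  moreover have "p ` {..<k} \<subseteq> picks k W"
    unfolding picks_def using p lp by auto
  moreover have "finite (picks k W)" using picks_subset fin finite_subset by blast
  ultimately have "k \<le> card (picks k W)" by (metis card_image card_lessThan card_mono)
  then show ?thesis using card_picks_le[OF fin tf, of k] by simp
qed

lemma not_exceeds_picks:
  assumes fin: "finite W" and u: "u \<in> W"
  shows "\<not> exceeds k (picks k W) u"
proof -
  have "level (picks k W) j = level W j" if "j < k" for j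
    using levels_picks[OF fin order_refl picks_subset that] .
  then have "exceeds k (picks k W) u \<longleftrightarrow> exceeds k W u" by (rule exceeds_cong)
  moreover have "\<not> exceeds k W u"
    using score_le_level[OF fin u] by (auto simp: exceeds_def not_less)
  ultimately show ?thesis by simp
qed

text \<open>Without violations outside \<open>W'\<close> both sets have the same levels, so
  \<open>W'\<close> cannot miss a selected scenario, and comparing cardinalities gives equality.
  With \<open>not_exceeds_picks\<close>, this is the uniqueness on which the moment computation
  rests.\<close>

lemma picks_unique:
  assumes fin: "finite W" and pos: "\<forall>u\<in>W. 0 < u" and tf: "tie_free W"
    and sub: "W' \<subseteq> W" "card W' = k"
    and nex: "\<And>u. u \<in> W - W' \<Longrightarrow> \<not> exceeds k W' u"
  shows "W' = picks k W"
proof -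
  have eq: "level W' j = level W j" if "j < k" for j
    using levels_eq_not_exceeds[OF fin sub(1) nex that] .
  have "picks k W \<subseteq> W'"
    using levels_neq_without_pick[OF fin tf _ sub(1)] eq by blast
  moreover have "card (picks k W) = k"
    using card_picks[OF fin pos tf] sub fin card_mono by metis
  moreover have "finite W'" using fin sub(1) finite_subset by blast
  ultimately show ?thesis using sub(2) card_subset_eq by metis
qed

text \<open>The degree doubles from stage to stage whatever the levels are, so a score is never
  constant.\<close>

lemma score_poly: "\<exists>p. degree p > 0 \<and> (\<forall>u. score W j u = poly p u)"
proof (induction j)
  case 0
  show ?case by (intro exI[of _ "[:0, 1:]"]) auto
next
  case (Suc j)
  then obtain p where p: "degree p > 0" "\<forall>u. score W j u = poly p u" by blast
  let ?q = "[:level W j:] - p"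
  have "degree ?q = degree p"
    using degree_add_eq_right[of "[:level W j:]" "- p"] p(1) by simp
  then have "degree (p * ?q) > 0" using p(1) by (subst degree_mult_eq) auto
  then show ?case using p(2) by (intro exI[of _ "p * ?q"]) (auto simp: score_Suc)
qed

lemma finite_score_level_set: "finite {u. score W j u = c}"
proof -
  obtain p where p: "degree p > 0" "\<And>u. score W j u = poly p u"
    using score_poly by blast
  have "p - [:c:] \<noteq> 0" using p(1) by auto
  then have "finite {u. poly (p - [:c:]) u = 0}" by (rule poly_roots_finite)
  then show ?thesis by (simp add: p(2))
qed

text \<open>
  This turns a tie into a polynomial equation in \<open>u\<close> whose coefficients do not depend on \<open>u\<close>.
\<close>

lemma tie_persists:
  assumes fin: "finite W" and uv: "u \<in> W" "v \<in> W"
    and tie: "score W j u = score W j v" "score W j u \<noteq> 0"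
  shows "score (W - {u, v}) j u = score (W - {u, v}) j v"
proof -
  have "level (W - {u, v}) i = level W i" if "i < j" for i
  proof (rule levels_eq_subset[OF fin _ _ that])
    fix i assume i: "i < j" "0 < level W i"
    obtain w where w: "w \<in> W" "score W i w = level W i"
      using level_attained[OF fin i(2)] by blast
    have "score W j w = 0" using score_eq_0_after[OF w(2) i(1)] .
    then have "w \<noteq> u" "w \<noteq> v" using tie by auto
    with w show "\<exists>u\<in>W - {u, v}. score W i u = level W i" by blast
  qed auto
  then have "score (W - {u, v}) j = score W j" by (rule score_cong_levels)
  with tie(1) show ?thesis by simp
qed

section \<open>A triangular geometric program\<close>

inductive posynomial :: "(real ^ 'n \<Rightarrow> real) \<Rightarrow> bool" where
  monomial: "0 \<le> c \<Longrightarrow> posynomial (\<lambda>x. c * exp (a \<bullet> x))"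
| add: "posynomial g \<Longrightarrow> posynomial h \<Longrightarrow> posynomial (\<lambda>x. g x + h x)"

lemma posynomial_monomial_mult:
  assumes "posynomial h" "0 \<le> c"
  shows "posynomial (\<lambda>x. (c * exp (a \<bullet> x)) * h x)"
  using assms(1)
proof induction
  case (monomial c' a')
  have "(\<lambda>x. c * exp (a \<bullet> x) * (c' * exp (a' \<bullet> x))) = (\<lambda>x. (c * c') * exp ((a + a') \<bullet> x))"
    by (simp add: fun_eq_iff exp_add inner_add_left)
  then show ?case using posynomial.monomial[of "c * c'" "a + a'"] assms(2) monomial by simp
next
  case (add g h)
  then show ?case using posynomial.add[OF add.IH] by (simp add: distrib_left)
qed

lemma posynomial_mult:
  assumes "posynomial g" "posynomial h"
  shows "posynomial (\<lambda>x. g x * h x)"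
  using assms(1)
proof induction
  case (monomial c a)
  then show ?case using posynomial_monomial_mult[OF assms(2)] by blast
next
  case (add g1 g2)
  then show ?case using posynomial.add[OF add.IH] by (simp add: distrib_right)
qed

lemma posynomial_const: "0 \<le> c \<Longrightarrow> posynomial (\<lambda>x. c)"
  using posynomial.monomial[of c 0] by simp

lemma posynomial_exp_component: "posynomial (\<lambda>x. exp (x $ i))"
  using posynomial.monomial[of 1 "axis i 1"] by (simp add: inner_axis')

lemma posynomial_exp_minus_component: "posynomial (\<lambda>x. exp (- (x $ i)))"
  using posynomial.monomial[of 1 "- axis i 1"] by (simp add: inner_axis')

lemma convex_on_posynomial:
  assumes "posynomial g"
  shows "convex_on UNIV g"
  using assms
proof induction
  case (monomial c a)
  have "convex_on UNIV (\<lambda>x. exp (a \<bullet> x))"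
  proof (rule convex_onI)
    fix t :: real and x y assume "0 < t" "t < 1"
    then show "exp (a \<bullet> ((1 - t) *\<^sub>R x + t *\<^sub>R y)) \<le> (1 - t) * exp (a \<bullet> x) + t * exp (a \<bullet> y)"
      using convex_onD[OF exp_convex, of t "a \<bullet> x" "a \<bullet> y"] by (simp add: inner_add_right)
  qed simp
  then show ?case using monomial by (rule convex_on_cmul[rotated])
next
  case (add g h)
  then show ?case by (intro convex_on_add)
qed

lemma continuous_on_posynomial: "posynomial g \<Longrightarrow> continuous_on UNIV g"
  by (induction rule: posynomial.induct) (auto intro!: continuous_intros)

lemma convex_sublevel:
  fixes g :: "'a::real_vector \<Rightarrow> real"
  assumes "convex_on UNIV g"
  shows "convex {x. g x \<le> c}"
  unfolding convex_alt
proof (clarsimp)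
  fix x y and t :: real assume xy: "g x \<le> c" "g y \<le> c" and t: "0 \<le> t" "t \<le> 1"
  have "g ((1 - t) *\<^sub>R x + t *\<^sub>R y) \<le> (1 - t) * g x + t * g y"
    using convex_onD[OF assms t] by simp
  also have "\<dots> \<le> (1 - t) * c + t * c"
    using xy t by (intro add_mono mult_left_mono) auto
  finally show "g ((1 - t) *\<^sub>R x + t *\<^sub>R y) \<le> c" by (simp add: algebra_simps)
qed

lemma convex_on_max_0:
  fixes g :: "'a::real_vector \<Rightarrow> real"
  assumes "convex_on S g"
  shows "convex_on S (\<lambda>x. max 0 (g x))"
proof (rule convex_onI)
  fix t :: real and x y assume t: "0 < t" "t < 1" and xy: "x \<in> S" "y \<in> S"
  have "g ((1 - t) *\<^sub>R x + t *\<^sub>R y) \<le> (1 - t) * g x + t * g y"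
    using convex_onD[OF assms, of t x y] t xy by simp
  also have "\<dots> \<le> (1 - t) * max 0 (g x) + t * max 0 (g y)"
    using t by (intro add_mono mult_left_mono) auto
  finally show "max 0 (g ((1 - t) *\<^sub>R x + t *\<^sub>R y)) \<le> (1 - t) * max 0 (g x) + t * max 0 (g y)"
    using t by simp
qed (use convex_on_imp_convex[OF assms] in simp)

text \<open>The value \<open>1\<close> at stage \<open>0\<close> dominates the first score, as
  scenarios satisfy \<open>u \<le> 1\<close>.\<close>

primrec base :: "(nat \<Rightarrow> real) \<Rightarrow> nat \<Rightarrow> real" where
  "base e 0 = 1"
| "base e (Suc j) = base e j * (e j + 2 * base e j)"

text \<open>If \<open>e j\<close> is \<open>base e j\<close> plus the level of stage
  \<open>j\<close>, the last factor is level minus score. So this is the score recurrence, written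
  in the program variables.\<close>

primrec gain :: "(nat \<Rightarrow> real) \<Rightarrow> nat \<Rightarrow> real \<Rightarrow> real" where
  "gain e 0 u = u"
| "gain e (Suc j) u = gain e j u * (e j - base e j - gain e j u)"

text \<open>
  The coefficients of \<open>base\<close> dominate those of \<open>gain\<close>: both sum and difference are polynomials
  in \<open>e\<close> with nonnegative coefficients. This is what the summand \<open>2 * base e j\<close> is for.
\<close>

lemma base_plus_gain_Suc:
  "base e (Suc j) + gain e (Suc j) u =
     e j * (base e j + gain e j u) + base e j * (base e j - gain e j u)
       + (base e j + gain e j u) * (base e j - gain e j u)"
  by (simp add: algebra_simps power2_eq_square)

lemma base_minus_gain_Suc:
  "base e (Suc j) - gain e (Suc j) u =
     e j * (base e j - gain e j u) + base e j * (base e j + gain e j u)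
       + (1 / 2) * ((base e j + gain e j u) * (base e j + gain e j u)
                  + (base e j - gain e j u) * (base e j - gain e j u))"
  by (simp add: algebra_simps power2_eq_square)

lemma base_mono:
  assumes "\<And>i. i < j \<Longrightarrow> 0 \<le> e i \<and> e i \<le> e' i"
  shows "0 \<le> base e j \<and> base e j \<le> base e' j"
  using assms
proof (induction j)
  case (Suc j)
  then have IH: "0 \<le> base e j" "base e j \<le> base e' j" and "0 \<le> e j" "e j \<le> e' j"
    by auto
  then show ?case by (auto intro!: mult_mono)
qed simp

text \<open>With \<open>p\<close> and \<open>q\<close> standing for base plus gain and base minus
  gain, these are the right-hand sides of the two identities above. Nonnegative coefficients make
  them monotone in all four arguments.\<close>

lemma nonneg_step_mono:
  fixes E B p q :: real
  assumes "0 \<le> E" "E \<le> E'" "0 \<le> B" "B \<le> B'" "0 \<le> p" "p \<le> p'" "0 \<le> q" "q \<le> q'"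
  shows "0 \<le> E * p + B * q + p * q" "E * p + B * q + p * q \<le> E' * p' + B' * q' + p' * q'"
    "0 \<le> E * q + B * p + (1 / 2) * (p * p + q * q)"
    "E * q + B * p + (1 / 2) * (p * p + q * q) \<le> E' * q' + B' * p' + (1 / 2) * (p' * p' + q' * q')"
proof -
  have "0 \<le> E'" "0 \<le> B'" "0 \<le> p'" "0 \<le> q'" using assms by linarith+
  with assms show "0 \<le> E * p + B * q + p * q" "E * p + B * q + p * q \<le> E' * p' + B' * q' + p' * q'"
    "0 \<le> E * q + B * p + (1 / 2) * (p * p + q * q)"
    "E * q + B * p + (1 / 2) * (p * p + q * q) \<le> E' * q' + B' * p' + (1 / 2) * (p' * p' + q' * q')"
    by (auto intro!: add_mono mult_mono add_nonneg_nonneg)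
qed

text \<open>\<open>gain\<close> alone has negative terms and need not be monotone in
  \<open>e\<close>; adding \<open>base\<close> restores monotonicity. The difference is carried
  along because each recurrence mixes sum and difference.\<close>

lemma base_gain_mono:
  assumes u: "0 \<le> u" "u \<le> 1" and e: "\<And>i. i < j \<Longrightarrow> 0 \<le> e i \<and> e i \<le> e' i"
  shows "0 \<le> base e j + gain e j u \<and> base e j + gain e j u \<le> base e' j + gain e' j u
       \<and> 0 \<le> base e j - gain e j u \<and> base e j - gain e j u \<le> base e' j - gain e' j u"
  using e
proof (induction j)
  case 0
  then show ?case using u by simp
next
  case (Suc j)
  then have IH: "0 \<le> base e j + gain e j u" "base e j + gain e j u \<le> base e' j + gain e' j u"
      "0 \<le> base e j - gain e j u" "base e j - gain e j u \<le> base e' j - gain e' j u"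
    and E: "0 \<le> e j" "e j \<le> e' j"
    by auto
  have B: "0 \<le> base e j" "base e j \<le> base e' j" using base_mono[of j e e'] Suc.prems by auto
  show ?case
    unfolding base_plus_gain_Suc base_minus_gain_Suc
    using nonneg_step_mono[OF E B IH] by blast
qed

section \<open>The convex program with \<open>k\<close> stages\<close>

context
  fixes k :: nat and \<pi> :: "nat \<Rightarrow> 'n::finite"
begin

definition stage_coord :: "real ^ 'n \<Rightarrow> nat \<Rightarrow> real" where
  "stage_coord x j = exp (x $ \<pi> j)"

text \<open>The stage inequalities encode the \<open>0\<close> in \<open>peak\<close>: levels cannot
  be negative even without scenarios. Coordinates that serve no stage are pinned to \<open>0\<close>
  to make the minimizer unique.\<close>

definition prog_dom :: "(real ^ 'n) set" where
  "prog_dom = {x. (\<forall>j<k. base (stage_coord x) j \<le> stage_coord x j) \<and> (\<forall>i. i \<notin> \<pi> ` {..<k} \<longrightarrow> x $ i = 0)}"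

text \<open>The class has one constraint function, so the \<open>k\<close> stage inequalities are
  merged into a sum of hinge terms. Dividing by \<open>exp (x $ \<pi> j)\<close> first turns each of
  them into a posynomial bounded by \<open>1\<close>, which is convex.\<close>

definition prog_constr :: "real ^ 'n \<Rightarrow> real \<Rightarrow> real" where
  "prog_constr x u =
     (\<Sum>j<k. max 0 ((base (stage_coord x) j + gain (stage_coord x) j u) * exp (- (x $ \<pi> j)) - 1))"

definition prog_obj :: "real ^ 'n \<Rightarrow> real" where
  "prog_obj x = (\<Sum>i\<in>UNIV. x $ i)"

definition prog_feasible :: "real set \<Rightarrow> real ^ 'n \<Rightarrow> bool" where
  "prog_feasible W x \<longleftrightarrow> x \<in> prog_dom \<and> (\<forall>u\<in>W. prog_constr x u \<le> 0)"

text \<open>Each recurrence mixes sum and difference, so both are carried through the induction;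
  having nonnegative coefficients, the recurrences stay within posynomials. The bounds on
  \<open>u\<close> serve stage \<open>0\<close>, where \<open>1 + u\<close> and \<open>1 - u\<close>
  must be nonnegative.\<close>

lemma posynomial_base_gain:
  assumes "0 \<le> u" "u \<le> 1"
  shows "posynomial (\<lambda>x. base (stage_coord x) j) \<and>
    posynomial (\<lambda>x. base (stage_coord x) j + gain (stage_coord x) j u) \<and>
    posynomial (\<lambda>x. base (stage_coord x) j - gain (stage_coord x) j u)"
proof (induction j)
  case 0
  show ?case using assms posynomial_const[of "1 + u"] posynomial_const[of "1 - u"] posynomial_const[of 1]
    by simp
next
  case (Suc j)
  have E: "posynomial (\<lambda>x. stage_coord x j)"
    unfolding stage_coord_def by (rule posynomial_exp_component)
  have step: "posynomial (\<lambda>x. b x * (e x + 2 * b x))"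
      "posynomial (\<lambda>x. e x * p x + b x * q x + p x * q x)"
      "posynomial (\<lambda>x. e x * q x + b x * p x + (1 / 2) * (p x * p x + q x * q x))"
    if "posynomial e" "posynomial b" "posynomial p" "posynomial q" for e b p q :: "real ^ 'n \<Rightarrow> real"
    using that by (intro posynomial.add posynomial_mult posynomial_const; simp)+
  from Suc have IH: "posynomial (\<lambda>x. base (stage_coord x) j)"
    "posynomial (\<lambda>x. base (stage_coord x) j + gain (stage_coord x) j u)"
    "posynomial (\<lambda>x. base (stage_coord x) j - gain (stage_coord x) j u)"
    by blast+
  show ?case
    unfolding base_plus_gain_Suc base_minus_gain_Suc unfolding base.simps(2)
    by (intro conjI step[OF E IH])
qed

lemma posynomial_base: "posynomial (\<lambda>x. base (stage_coord x) j)"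
  using posynomial_base_gain[of 0] by simp

lemma base_le_iff:
  "base (stage_coord x) j \<le> stage_coord x j \<longleftrightarrow> base (stage_coord x) j * exp (- (x $ \<pi> j)) \<le> 1"
  by (simp add: stage_coord_def exp_minus field_simps)

lemma prog_dom_alt:
  "prog_dom = (\<Inter>j\<in>{..<k}. {x. base (stage_coord x) j * exp (- (x $ \<pi> j)) \<le> 1})
       \<inter> (\<Inter>i\<in>- \<pi> ` {..<k}. {x. x $ i = 0})"
  unfolding prog_dom_def base_le_iff by auto

lemma convex_prog_dom: "convex prog_dom"
proof -
  have "convex {x. base (stage_coord x) j * exp (- (x $ \<pi> j)) \<le> 1}" for j
  proof -
    have "convex_on UNIV (\<lambda>x. base (stage_coord x) j * exp (- (x $ \<pi> j)))"
      by (intro convex_on_posynomial posynomial_mult posynomial_base posynomial_exp_minus_component)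
    then show ?thesis by (rule convex_sublevel)
  qed
  moreover have "convex {x::real ^ 'n. x $ i = 0}" for i
    unfolding convex_def by simp
  ultimately show ?thesis unfolding prog_dom_alt by (intro convex_Int convex_INT) auto
qed

lemma closed_prog_dom: "closed prog_dom"
proof -
  have "closed {x. base (stage_coord x) j * exp (- (x $ \<pi> j)) \<le> 1}" for j
    using continuous_on_posynomial[OF posynomial_mult[OF posynomial_base posynomial_exp_minus_component]]
    by (intro closed_Collect_le) auto
  moreover have "closed {x::real ^ 'n. x $ i = 0}" for i
    by (intro closed_Collect_eq continuous_intros)
  ultimately show ?thesis unfolding prog_dom_alt by (intro closed_Int closed_INT) auto
qed

lemma convex_prog_obj: "convex_on UNIV prog_obj"
  unfolding prog_obj_def
  by (rule convex_onI) (auto simp: sum.distrib sum_distrib_left)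

lemma posynomial_constr:
  assumes "0 \<le> u" "u \<le> 1"
  shows "posynomial (\<lambda>x. (base (stage_coord x) j + gain (stage_coord x) j u) * exp (- (x $ \<pi> j)))"
  using posynomial_base_gain[OF assms] by (intro posynomial_mult posynomial_exp_minus_component) auto

lemma convex_prog_constr:
  assumes "0 \<le> u" "u \<le> 1"
  shows "convex_on UNIV (\<lambda>x. prog_constr x u)"
  unfolding prog_constr_def
proof (induction k)
  case 0
  show ?case by (simp add: convex_on_def)
next
  case (Suc k)
  have "convex_on UNIV (\<lambda>x. (base (stage_coord x) k + gain (stage_coord x) k u) * exp (- (x $ \<pi> k)) + - 1)"
    by (rule convex_on_add[OF convex_on_posynomial[OF posynomial_constr[OF assms]]])
      (simp add: convex_on_const)
  then show ?case
    unfolding sum.lessThan_Suc by (intro convex_on_add Suc convex_on_max_0) simp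
qed

lemma continuous_prog_constr:
  assumes "0 \<le> u" "u \<le> 1"
  shows "continuous_on UNIV (\<lambda>x. prog_constr x u)"
  unfolding prog_constr_def
  by (intro continuous_intros continuous_on_posynomial posynomial_constr assms)

lemma prog_constr_nonneg: "0 \<le> prog_constr x u"
  unfolding prog_constr_def by (intro sum_nonneg) auto

lemma prog_constr_le_0_iff:
  "prog_constr x u \<le> 0 \<longleftrightarrow>
    (\<forall>j<k. base (stage_coord x) j + gain (stage_coord x) j u \<le> stage_coord x j)"
proof -
  have "prog_constr x u \<le> 0 \<longleftrightarrow> prog_constr x u = 0" using prog_constr_nonneg[of x u] by linarith
  also have "\<dots> \<longleftrightarrow>
    (\<forall>j<k. max 0 ((base (stage_coord x) j + gain (stage_coord x) j u) * exp (- (x $ \<pi> j)) - 1) = 0)"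
    unfolding prog_constr_def by (subst sum_nonneg_eq_0_iff) auto
  also have "\<dots> \<longleftrightarrow> (\<forall>j<k. base (stage_coord x) j + gain (stage_coord x) j u \<le> stage_coord x j)"
  proof -
    have "max 0 (a * exp (- c) - 1) = 0 \<longleftrightarrow> a \<le> exp c" for a c :: real
      by (simp add: exp_minus field_simps max_def not_le le_less)
    then show ?thesis by (simp add: stage_coord_def)
  qed
  finally show ?thesis .
qed

text \<open>This is \<open>base\<close> evaluated at \<open>e j = opt_base W j + level W j\<close>,
  the smallest value that stage \<open>j\<close> permits; the factor \<open>3\<close> is
  \<open>1 + 2\<close>.\<close>

primrec opt_base :: "real set \<Rightarrow> nat \<Rightarrow> real" where
  "opt_base W 0 = 1"
| "opt_base W (Suc j) = opt_base W j * (level W j + 3 * opt_base W j)"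

definition opt :: "real set \<Rightarrow> real ^ 'n" where
  "opt W = (\<chi> i. if i \<in> \<pi> ` {..<k}
     then ln (opt_base W (inv_into {..<k} \<pi> i) + level W (inv_into {..<k} \<pi> i)) else 0)"

lemma opt_base_pos: "finite W \<Longrightarrow> 0 < opt_base W j"
  by (induction j) (auto intro!: mult_pos_pos add_nonneg_pos simp: level_nonneg)

context
  assumes inj: "inj_on \<pi> {..<k}"
begin

lemma opt_component:
  "j < k \<Longrightarrow> opt W $ \<pi> j = ln (opt_base W j + level W j)"
  using inj by (auto simp: opt_def)

lemma opt_other: "i \<notin> \<pi> ` {..<k} \<Longrightarrow> opt W $ i = 0"
  by (simp add: opt_def)

lemma stage_coord_opt:
  assumes "finite W" "j < k"
  shows "stage_coord (opt W) j = opt_base W j + level W j"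
  using opt_base_pos[OF assms(1), of j] level_nonneg[OF assms(1), of j]
  by (simp add: stage_coord_def opt_component assms(2) add_pos_nonneg)

lemma base_opt: "finite W \<Longrightarrow> j \<le> k \<Longrightarrow> base (stage_coord (opt W)) j = opt_base W j"
  by (induction j) (auto simp: stage_coord_opt)

lemma gain_opt: "finite W \<Longrightarrow> j \<le> k \<Longrightarrow> gain (stage_coord (opt W)) j u = score W j u"
  by (induction j) (auto simp: stage_coord_opt base_opt score_Suc)

lemma prog_constr_opt:
  assumes "finite W"
  shows "prog_constr (opt W) u > 0 \<longleftrightarrow> exceeds k W u"
proof -
  have "prog_constr (opt W) u > 0 \<longleftrightarrow> \<not> prog_constr (opt W) u \<le> 0" by auto
  also have "\<dots> \<longleftrightarrow> exceeds k W u"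
    unfolding prog_constr_le_0_iff exceeds_def
    by (auto simp: base_opt gain_opt stage_coord_opt assms not_le)
  finally show ?thesis .
qed

text \<open>\<open>base\<close> can be recomputed from the earlier coordinates, so each stage
  coordinate reveals its level.\<close>

lemma opt_eq_iff:
  assumes "finite W" "finite W'"
  shows "opt W = opt W' \<longleftrightarrow> (\<forall>j<k. level W j = level W' j)"
proof
  assume eq: "opt W = opt W'"
  show "\<forall>j<k. level W j = level W' j"
  proof (intro allI impI)
    fix j assume j: "j < k"
    have "opt_base W j = opt_base W' j"
      using base_opt[OF assms(1), of j] base_opt[OF assms(2), of j] j eq by simp
    then show "level W j = level W' j"
      using stage_coord_opt[OF assms(1) j] stage_coord_opt[OF assms(2) j] eq by simp
  qed
next
  assume eq: "\<forall>j<k. level W j = level W' j"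
  have "opt_base W j = opt_base W' j" if "j \<le> k" for j
    using that eq by (induction j) auto
  then have "opt W $ \<pi> j = opt W' $ \<pi> j" if "j < k" for j
    using eq that by (simp add: opt_component)
  then show "opt W = opt W'"
    unfolding vec_eq_iff by (metis imageE lessThan_iff opt_other)
qed

lemma opt_feasible:
  assumes "finite W"
  shows "prog_feasible W (opt W)"
  unfolding prog_feasible_def prog_dom_def prog_constr_le_0_iff
  using assms score_le_level[OF assms] level_nonneg[OF assms]
  by (auto simp: base_opt gain_opt stage_coord_opt opt_other)

text \<open>The triangular shape allows comparing the stages in order: smaller earlier coordinates
  give a smaller base and a smaller base plus gain, hence a smaller lower bound on the next
  coordinate.\<close>

lemma opt_least:
  assumes fin: "finite W" and W: "\<forall>u\<in>W. 0 \<le> u \<and> u \<le> 1" and x: "prog_feasible W x"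
  shows "opt W $ i \<le> x $ i"
proof -
  have le: "stage_coord (opt W) j \<le> stage_coord x j" if "j < k" for j
    using that
  proof (induction j rule: less_induct)
    case (less j)
    have IH: "0 \<le> stage_coord (opt W) i \<and> stage_coord (opt W) i \<le> stage_coord x i" if "i < j" for i
      using less that by (simp add: stage_coord_def)
    have "level W j \<le> stage_coord x j - opt_base W j"
      unfolding level_def peak_le_iff[OF fin]
    proof (intro conjI ballI)
      have "base (stage_coord (opt W)) j \<le> base (stage_coord x) j" using base_mono IH by blast
      also have "\<dots> \<le> stage_coord x j"
        using x less.prems unfolding prog_feasible_def prog_dom_def by blast
      finally show "0 \<le> stage_coord x j - opt_base W j"
        using base_opt[OF fin] less.prems by simp
    next
      fix u assume u: "u \<in> W"
      have "base (stage_coord (opt W)) j + gain (stage_coord (opt W)) j u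
          \<le> base (stage_coord x) j + gain (stage_coord x) j u"
        using base_gain_mono[of u j "stage_coord (opt W)" "stage_coord x"] IH W u by blast
      also have "\<dots> \<le> stage_coord x j"
        using x less.prems u unfolding prog_feasible_def prog_constr_le_0_iff by blast
      finally show "score W j u \<le> stage_coord x j - opt_base W j"
        using base_opt[OF fin] gain_opt[OF fin] less.prems by simp
    qed
    then show ?case using stage_coord_opt[OF fin less.prems] by simp
  qed
  show ?thesis
  proof (cases "i \<in> \<pi> ` {..<k}")
    case True
    then show ?thesis using le by (auto simp: stage_coord_def)
  next
    case False
    then show ?thesis using x by (simp add: opt_other prog_feasible_def prog_dom_def)
  qed
qed

text \<open>A componentwise least feasible point is the only minimizer of the coordinate sum: equal
  sums force equality in every coordinate.\<close>

lemma is_arg_min_opt_iff: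
  assumes fin: "finite W" and W: "\<forall>u\<in>W. 0 \<le> u \<and> u \<le> 1"
  shows "is_arg_min prog_obj (prog_feasible W) x \<longleftrightarrow> x = opt W"
proof
  have le: "prog_obj (opt W) \<le> prog_obj y" if "prog_feasible W y" for y
    unfolding prog_obj_def using opt_least[OF fin W that] by (intro sum_mono) auto
  then show "x = opt W \<Longrightarrow> is_arg_min prog_obj (prog_feasible W) x"
    using opt_feasible[OF fin] by (auto simp: is_arg_min_def not_less)
  assume x: "is_arg_min prog_obj (prog_feasible W) x"
  then have fx: "prog_feasible W x" by (simp add: is_arg_min_def)
  have "prog_obj x \<le> prog_obj (opt W)"
    using x opt_feasible[OF fin] by (auto simp: is_arg_min_def not_less)
  then have "(\<Sum>i\<in>UNIV. x $ i - opt W $ i) \<le> 0"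
    by (simp add: prog_obj_def sum_subtractf)
  moreover have nn: "0 \<le> x $ i - opt W $ i" for i using opt_least[OF fin W fx, of i] by simp
  ultimately have "(\<Sum>i\<in>UNIV. x $ i - opt W $ i) = 0"
    by (meson antisym sum_nonneg)
  then have "\<forall>i. x $ i - opt W $ i = 0"
    using nn by (subst (asm) sum_nonneg_eq_0_iff) auto
  then show "x = opt W" by (simp add: vec_eq_iff)
qed

end

end

section \<open>Binomial tails and beta densities\<close>

text \<open>For \<open>m < n\<close> this is the density of the beta distribution with parameters
  \<open>m + 1\<close> and \<open>n - m\<close>.\<close>

definition beta_density :: "nat \<Rightarrow> nat \<Rightarrow> real \<Rightarrow> real" where
  "beta_density n m t = real (Suc m) * real (n choose Suc m) * t ^ m * (1 - t) ^ (n - Suc m)"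

lemma binom_tail_Suc:
  "binom_tail n t (Suc m) = binom_tail n t m + real (n choose Suc m) * t ^ Suc m * (1 - t) ^ (n - Suc m)"
  by (simp add: binom_tail_def)

lemma binom_tail_0: "binom_tail n t 0 = (1 - t) ^ n"
  by (simp add: binom_tail_def)

text \<open>The sum telescopes: the derivative of the new term is
  \<open>beta_density n m t - beta_density n (Suc m) t\<close>, whose first part cancels the
  derivative of the previous tail.\<close>

lemma DERIV_binom_tail:
  assumes "m < n"
  shows "((\<lambda>t. binom_tail n t m) has_real_derivative - beta_density n m t) (at t)"
  using assms
proof (induction m)
  case 0
  show ?case unfolding binom_tail_0 beta_density_def
    by (auto intro!: derivative_eq_intros)
next
  case (Suc m)
  let ?c = "real (n choose Suc m)"
  have "((\<lambda>t. t ^ Suc m) has_real_derivative real (Suc m) * t ^ m) (at t)"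
    using DERIV_pow[of "Suc m" t] by simp
  moreover have "((\<lambda>t. (1 - t) ^ (n - Suc m)) has_real_derivative
      - (real (n - Suc m) * (1 - t) ^ (n - Suc m - Suc 0))) (at t)"
    by (auto intro!: derivative_eq_intros)
  ultimately have "((\<lambda>t. ?c * (t ^ Suc m * (1 - t) ^ (n - Suc m))) has_real_derivative
      ?c * (real (Suc m) * t ^ m * (1 - t) ^ (n - Suc m)
        + - (real (n - Suc m) * (1 - t) ^ (n - Suc m - Suc 0)) * t ^ Suc m)) (at t)"
    by (intro DERIV_cmult DERIV_mult)
  then have "((\<lambda>t. ?c * t ^ Suc m * (1 - t) ^ (n - Suc m)) has_real_derivative
      ?c * (real (Suc m) * t ^ m) * (1 - t) ^ (n - Suc m)
        - ?c * t ^ Suc m * (real (n - Suc m) * (1 - t) ^ (n - Suc m - Suc 0))) (at t)"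
    by (simp only: mult.assoc right_diff_distrib diff_conv_add_uminus distrib_left
        mult_minus_left mult_minus_right) (simp add: mult_ac)
  moreover have "?c * t ^ Suc m * (real (n - Suc m) * (1 - t) ^ (n - Suc m - Suc 0)) = beta_density n (Suc m) t"
  proof -
    have absorb: "real (n - Suc m) * ?c = real (Suc (Suc m)) * real (n choose Suc (Suc m))"
      using Suc.prems
      by (metis binomial_absorb_comp binomial_absorption diff_Suc_1 mult.commute of_nat_mult Suc_diff_Suc)
    have "?c * t ^ Suc m * (real (n - Suc m) * (1 - t) ^ (n - Suc m - Suc 0))
        = (real (n - Suc m) * ?c) * t ^ Suc m * (1 - t) ^ (n - Suc m - Suc 0)"
      by (simp only: mult_ac)
    then show ?thesis
      unfolding absorb beta_density_def by (simp only: diff_diff_left add_Suc_right add_0_right)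
  qed
  moreover have "?c * (real (Suc m) * t ^ m) * (1 - t) ^ (n - Suc m) = beta_density n m t"
    unfolding beta_density_def by (simp add: algebra_simps)
  ultimately have "((\<lambda>t. ?c * t ^ Suc m * (1 - t) ^ (n - Suc m)) has_real_derivative
      beta_density n m t - beta_density n (Suc m) t) (at t)"
    by simp
  from DERIV_add[OF Suc.IH this] Suc.prems show ?case
    unfolding binom_tail_Suc by simp
qed

lemma binom_tail_at_0: "binom_tail n 0 m = 1"
  by (induction m) (simp_all add: binom_tail_Suc binom_tail_0)

lemma binom_tail_at_1: "m < n \<Longrightarrow> binom_tail n 1 m = 0"
  by (induction m) (simp_all add: binom_tail_Suc binom_tail_0)

lemma continuous_on_binom_tail: "continuous_on S (\<lambda>t. binom_tail n t m)"
  unfolding binom_tail_def by (intro continuous_intros)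

lemma continuous_on_beta_density: "continuous_on S (beta_density n m)"
  unfolding beta_density_def[abs_def] by (intro continuous_intros)

lemma beta_density_nonneg: "0 \<le> t \<Longrightarrow> t \<le> 1 \<Longrightarrow> 0 \<le> beta_density n m t"
  by (simp add: beta_density_def)

lemma has_integral_beta_density:
  assumes "m < n" "a \<le> b"
  shows "(beta_density n m has_integral binom_tail n a m - binom_tail n b m) {a..b}"
proof -
  have "(beta_density n m has_integral - binom_tail n b m - - binom_tail n a m) {a..b}"
  proof (rule fundamental_theorem_of_calculus[OF assms(2)])
    fix t
    have "((\<lambda>t. - binom_tail n t m) has_real_derivative beta_density n m t) (at t)"
      using DERIV_minus[OF DERIV_binom_tail[OF assms(1)], of t] by simp
    then show "((\<lambda>t. - binom_tail n t m) has_vector_derivative beta_density n m t) (at t within {a..b})"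
      unfolding has_real_derivative_iff_has_vector_derivative by (rule has_vector_derivative_at_within)
  qed
  then show ?thesis by simp
qed

lemma binom_tail_strict_antimono:
  assumes "m < n" "0 \<le> a" "a < b" "b \<le> 1"
  shows "binom_tail n b m < binom_tail n a m"
proof (rule DERIV_neg_imp_decreasing_open[OF assms(3)])
  fix t assume t: "a < t" "t < b"
  have "0 < beta_density n m t"
    using t assms by (simp add: beta_density_def zero_less_mult_iff)
  then show "\<exists>y. ((\<lambda>t. binom_tail n t m) has_real_derivative y) (at t) \<and> y < 0"
    using DERIV_binom_tail[OF assms(1)] by (intro exI conjI) auto
qed (rule continuous_on_binom_tail)

lemma zcoef_pos: "1 \<le> k \<Longrightarrow> k \<le> N \<Longrightarrow> j \<le> M \<Longrightarrow> 0 < zcoef N M k j"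
  by (simp add: zcoef_def)

section \<open>Roots of the equation for the lower limit\<close>

context
  fixes N M k l :: nat
  assumes k: "1 \<le> k" "k < N" and l: "l \<le> M"
begin

lemma limit_sum_strict_antimono:
  assumes "0 \<le> a" "a < b" "b \<le> 1"
  shows "(\<Sum>j = 0..l. zcoef N M k j * binom_tail (N + M) b (k + j - 1))
       < (\<Sum>j = 0..l. zcoef N M k j * binom_tail (N + M) a (k + j - 1))"
  using k l assms
  by (intro sum_strict_mono mult_strict_left_mono binom_tail_strict_antimono zcoef_pos) auto

text \<open>The left-hand side decreases strictly and continuously from the sum of the coefficients
  at \<open>0\<close> to \<open>0\<close> at \<open>1\<close>. A positive value is therefore taken
  in between exactly if it lies below that sum.\<close>

lemma limit_root_exists_iff:
  assumes "0 < \<beta>"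
  shows "(\<exists>e. is_limit_root N M \<beta> k l e) \<longleftrightarrow> \<beta> < (\<Sum>j = 0..l. zcoef N M k j)"
proof
  let ?G = "\<lambda>e. \<Sum>j = 0..l. zcoef N M k j * binom_tail (N + M) e (k + j - 1)"
  have G0: "?G 0 = (\<Sum>j = 0..l. zcoef N M k j)" by (simp add: binom_tail_at_0)
  have G1: "?G 1 = 0" using k l by (intro sum.neutral) (auto simp: binom_tail_at_1)
  {
    assume "\<exists>e. is_limit_root N M \<beta> k l e"
    then obtain e where "0 < e" "e < 1" "?G e = \<beta>" unfolding is_limit_root_def by blast
    then show "\<beta> < (\<Sum>j = 0..l. zcoef N M k j)"
      using limit_sum_strict_antimono[of 0 e] G0 by simp
  }
  assume b: "\<beta> < (\<Sum>j = 0..l. zcoef N M k j)"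
  have "continuous_on {0..1} ?G" by (intro continuous_intros continuous_on_binom_tail)
  then obtain e where e: "0 \<le> e" "e \<le> 1" "?G e = \<beta>"
    using IVT2'[of ?G 1 \<beta> 0] G0 G1 assms b by auto
  moreover have "e \<noteq> 0" "e \<noteq> 1" using e G0 G1 assms b by auto
  ultimately show "\<exists>e. is_limit_root N M \<beta> k l e"
    unfolding is_limit_root_def by (intro exI[of _ e]) auto
qed

lemma limit_root_unique:
  assumes "is_limit_root N M \<beta> k l e" "is_limit_root N M \<beta> k l e'"
  shows "e = e'"
  using assms limit_sum_strict_antimono[of e e'] limit_sum_strict_antimono[of e' e]
  unfolding is_limit_root_def by (cases e e' rule: linorder_cases) auto

end

text \<open>Up to the factor \<open>(m + k) choose k\<close>, the integrand is again a beta density,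
  of total mass \<open>1\<close>.\<close>

lemma beta_density_moment:
  assumes "1 \<le> k"
  shows "((\<lambda>v. (1 - v) ^ m * beta_density k (k - 1) v) has_integral 1 / real ((m + k) choose k)) {0..1}"
proof -
  have "beta_density (m + k) (k - 1) v = real ((m + k) choose k) * ((1 - v) ^ m * beta_density k (k - 1) v)" for v
    using assms by (simp add: beta_density_def algebra_simps)
  then have "beta_density (m + k) (k - 1) = (\<lambda>v. real ((m + k) choose k) * ((1 - v) ^ m * beta_density k (k - 1) v))"
    by blast
  moreover have "(beta_density (m + k) (k - 1) has_integral 1) {0..1}"
    using has_integral_beta_density[of "k - 1" "m + k" 0 1] assms
    by (simp add: binom_tail_at_0 binom_tail_at_1)
  ultimately have "((\<lambda>v. (1 / real ((m + k) choose k)) * (real ((m + k) choose k) * ((1 - v) ^ m * beta_density k (k - 1) v)))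
      has_integral (1 / real ((m + k) choose k)) * 1) {0..1}"
    by (intro has_integral_mult_right) simp
  then show ?thesis by (simp add: zero_less_binomial_iff)
qed

text \<open>Moments determine a law on the unit interval: \<open>h\<close> is uniformly close to a
  polynomial there, and expectations of polynomials are fixed by the moments. Both the expectation
  and the integral then err by at most \<open>e / 2\<close>.\<close>

lemma expectation_from_moments:
  fixes \<nu> :: "real measure"
  assumes "prob_space \<nu>" and sets: "sets \<nu> = sets borel"
    and supp: "AE v in \<nu>. 0 \<le> v \<and> v \<le> 1"
    and k: "1 \<le> k"
    and moments: "\<And>m. integral\<^sup>L \<nu> (\<lambda>v. (1 - v) ^ m) = 1 / real ((m + k) choose k)"
    and h: "continuous_on UNIV h"
  shows "integral\<^sup>L \<nu> h = integral {0..1} (\<lambda>v. h v * beta_density k (k - 1) v)"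
proof -
  interpret prob_space \<nu> by fact
  define D where "D = beta_density k (k - 1)"
  have Dcont: "continuous_on S D" for S unfolding D_def by (rule continuous_on_beta_density)
  have int_D: "(D has_integral 1) {0..1}"
    using beta_density_moment[OF k, of 0] unfolding D_def by simp
  have D0: "0 \<le> D v" if "v \<in> {0..1}" for v using that unfolding D_def by (simp add: beta_density_nonneg)
  have meas: "g \<in> borel_measurable \<nu>" if "continuous_on UNIV g" for g :: "real \<Rightarrow> real"
    using borel_measurable_continuous_onI[OF that] by (subst measurable_cong_sets[OF sets refl])
  have int: "integrable \<nu> g" if g: "continuous_on UNIV g" for g :: "real \<Rightarrow> real"
  proof -
    have "compact (g ` {0..1})"
      using g by (intro compact_continuous_image continuous_on_subset[OF g]) auto
    then obtain B where B: "\<And>v. v \<in> {0..1} \<Longrightarrow> norm (g v) \<le> B"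
      by (metis bounded_iff compact_imp_bounded imageI)
    show ?thesis
      by (rule integrable_const_bound[of _ B, OF _ meas[OF g]]) (use supp B in auto)
  qed
  have "\<bar>integral\<^sup>L \<nu> h - integral {0..1} (\<lambda>v. h v * D v)\<bar> \<le> e" if e: "0 < e" for e
  proof -
    \<comment> \<open>The approximation is made in \<open>w = 1 - v\<close>, because the known
      moments are those of \<open>1 - v\<close>.\<close>
    have "continuous_on {0..1} (\<lambda>w. h (1 - w))"
      by (intro continuous_on_compose2[OF h] continuous_intros) auto
    from Stone_Weierstrass_real_polynomial_function[OF _ this, of "e / 2"] e
    obtain g where g: "real_polynomial_function g" "\<And>w. w \<in> {0..1} \<Longrightarrow> \<bar>h (1 - w) - g w\<bar> < e / 2"
      by auto
    obtain a n where an: "g = (\<lambda>w. \<Sum>i\<le>n. a i * w ^ i)"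
      using g(1) unfolding real_polynomial_function_iff_sum by blast
    define p where "p v = (\<Sum>i\<le>n. a i * (1 - v) ^ i)" for v
    have pcont: "continuous_on S p" for S unfolding p_def[abs_def] by (intro continuous_intros)
    have close: "\<bar>h v - p v\<bar> \<le> e / 2" if "v \<in> {0..1}" for v
      using g(2)[of "1 - v"] that by (auto simp: an p_def)
    have pI: "((\<lambda>v. p v * D v) has_integral (\<Sum>i\<le>n. a i * (1 / real ((i + k) choose k)))) {0..1}"
      unfolding p_def sum_distrib_right mult.assoc D_def
      by (intro has_integral_sum has_integral_mult_right beta_density_moment k) auto
    have "integral\<^sup>L \<nu> p = (\<Sum>i\<le>n. integral\<^sup>L \<nu> (\<lambda>v. a i * (1 - v) ^ i))"
      unfolding p_def by (intro Bochner_Integration.integral_sum int continuous_intros)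
    also have "\<dots> = (\<Sum>i\<le>n. a i * (1 / real ((i + k) choose k)))"
      using moments by simp
    finally have pN: "integral\<^sup>L \<nu> p = integral {0..1} (\<lambda>v. p v * D v)"
      using integral_unique[OF pI] by simp
    have "\<bar>integral\<^sup>L \<nu> h - integral\<^sup>L \<nu> p\<bar> = \<bar>integral\<^sup>L \<nu> (\<lambda>v. h v - p v)\<bar>"
      using int[OF h] int[OF pcont] by simp
    also have "\<dots> \<le> integral\<^sup>L \<nu> (\<lambda>v. \<bar>h v - p v\<bar>)"
      by (rule integral_abs_bound)
    also have "\<dots> \<le> integral\<^sup>L \<nu> (\<lambda>v. e / 2)"
      using supp close h pcont
      by (intro integral_mono_AE int continuous_intros) auto
    finally have 1: "\<bar>integral\<^sup>L \<nu> h - integral\<^sup>L \<nu> p\<bar> \<le> e / 2" by (simp add: prob_space)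
    have hD: "(\<lambda>v. h v * D v) integrable_on {0..1}"
      by (intro integrable_continuous_interval continuous_on_mult continuous_on_subset[OF h] Dcont) auto
    have "\<bar>integral {0..1} (\<lambda>v. h v * D v) - integral {0..1} (\<lambda>v. p v * D v)\<bar>
        = norm (integral {0..1} (\<lambda>v. h v * D v - p v * D v))"
      using integral_diff[OF hD] pI by (auto simp: has_integral_integrable_integral)
    also have "\<dots> \<le> integral {0..1} (\<lambda>v. e / 2 * D v)"
    proof (rule integral_norm_bound_integral)
      show "(\<lambda>v. h v * D v - p v * D v) integrable_on {0..1}"
        using integrable_diff[OF hD] pI by blast
      show "(\<lambda>v. e / 2 * D v) integrable_on {0..1}"
        by (intro integrable_continuous_interval continuous_intros Dcont)
      fix v :: real assume v: "v \<in> {0..1}"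
      have "norm (h v * D v - p v * D v) = \<bar>h v - p v\<bar> * D v"
        using D0[OF v] by (simp add: abs_mult flip: left_diff_distrib)
      also have "\<dots> \<le> e / 2 * D v" using close[OF v] D0[OF v] by (rule mult_right_mono)
      finally show "norm (h v * D v - p v * D v) \<le> e / 2 * D v" .
    qed
    also have "\<dots> = e / 2" using int_D by (simp add: integral_unique)
    finally show ?thesis using 1 pN by linarith
  qed
  then have "\<bar>integral\<^sup>L \<nu> h - integral {0..1} (\<lambda>v. h v * D v)\<bar> \<le> 0"
    by (rule field_le_epsilon) auto
  then show ?thesis by (simp add: D_def)
qed

text \<open>Origin of \<open>zcoef\<close>: it is \<open>(N choose k) * (M choose j) * k\<close>
  divided by the normalizing constant \<open>(k + j) * ((N + M) choose (k + j))\<close> of the beta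
  density.\<close>

lemma zcoef_beta_density:
  assumes "1 \<le> k" "k \<le> N" "j \<le> M"
  shows "real (N choose k) * real (M choose j) * (v ^ j * (1 - v) ^ (N + M - k - j)) * beta_density k (k - 1) v
      = zcoef N M k j * beta_density (N + M) (k + j - 1) v"
proof -
  have cancel: "A * B * (x * y) * (q * z) = A * B / C * (q / s) * (s * C * (z * x) * y)"
    if "C \<noteq> 0" "s \<noteq> 0" for A B C q s x y z :: real
    using that by (simp add: field_simps)
  obtain k' where k': "k = Suc k'" using assms by (cases k) auto
  have C: "real ((N + M) choose (Suc k' + j)) \<noteq> 0" using assms k' by simp
  show ?thesis
    unfolding zcoef_def beta_density_def k'
    using cancel[OF C, of "real (Suc k' + j)" "real (N choose Suc k')" "real (M choose j)" "v ^ j"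
        "(1 - v) ^ (N + M - Suc k' - j)" "real (Suc k')" "v ^ k'"]
    by (simp add: power_add del: binomial_Suc_Suc of_nat_Suc)
qed

text \<open>The indicator of \<open>{a<..}\<close> is not continuous, so the moments are applied to
  a ramp below it, rising from \<open>0\<close> at \<open>a\<close> to \<open>1\<close> at
  \<open>c\<close>. The price is evaluating the tails at \<open>c\<close> instead of
  \<open>a\<close>; since \<open>c\<close> may be arbitrarily close to \<open>a\<close>, this is
  harmless later.\<close>

lemma truncated_expectation_ge:
  fixes \<nu> :: "real measure" and N M k l :: nat
  defines "\<phi> \<equiv> \<lambda>v. \<Sum>j\<le>l. real (N choose k) * real (M choose j) * (v ^ j * (1 - v) ^ (N + M - k - j))"
  assumes "prob_space \<nu>" and sets: "sets \<nu> = sets borel"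
    and supp: "AE v in \<nu>. 0 \<le> v \<and> v \<le> 1"
    and k: "1 \<le> k" "k < N" and l: "l \<le> M"
    and moments: "\<And>m. integral\<^sup>L \<nu> (\<lambda>v. (1 - v) ^ m) = 1 / real ((m + k) choose k)"
    and c: "0 \<le> a" "a < c" "c \<le> 1"
  shows "(\<Sum>j = 0..l. zcoef N M k j * binom_tail (N + M) c (k + j - 1))
       \<le> integral\<^sup>L \<nu> (\<lambda>v. indicator {a<..} v * \<phi> v)"
proof -
  interpret prob_space \<nu> by fact
  define D where "D = beta_density k (k - 1)"
  define r where "r v = max 0 (min 1 ((v - a) / (c - a)))" for v
  have r: "0 \<le> r v" "r v \<le> 1" "c \<le> v \<Longrightarrow> r v = 1" "v \<le> a \<Longrightarrow> r v = 0" for v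
    using c by (auto simp: r_def field_simps max_def min_def)
  have rcont: "continuous_on S r" for S
    unfolding r_def[abs_def] using c by (intro continuous_intros) auto
  have \<phi>cont: "continuous_on S \<phi>" for S unfolding \<phi>_def by (intro continuous_intros)
  have \<phi>0: "0 \<le> \<phi> v" if "0 \<le> v" "v \<le> 1" for v
    using that unfolding \<phi>_def by (intro sum_nonneg) auto
  have Dcont: "continuous_on S D" for S unfolding D_def by (rule continuous_on_beta_density)
  have D0: "0 \<le> D v" if "0 \<le> v" "v \<le> 1" for v using that unfolding D_def by (simp add: beta_density_nonneg)
  have meas: "g \<in> borel_measurable \<nu>" if "g \<in> borel_measurable borel" for g :: "real \<Rightarrow> real"
    using that by (subst measurable_cong_sets[OF sets refl])
  have "compact (\<phi> ` {0..1})" by (intro compact_continuous_image \<phi>cont) auto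
  then obtain B where B: "\<And>v. v \<in> {0..1} \<Longrightarrow> norm (\<phi> v) \<le> B"
    by (metis bounded_iff compact_imp_bounded imageI)
  have "\<phi> v * D v = (\<Sum>j\<le>l. zcoef N M k j * beta_density (N + M) (k + j - 1) v)" for v
    unfolding \<phi>_def D_def sum_distrib_right
    using k l by (intro sum.cong zcoef_beta_density) auto
  then have "((\<lambda>v. \<phi> v * D v) has_integral
      (\<Sum>j\<le>l. zcoef N M k j * (binom_tail (N + M) c (k + j - 1) - binom_tail (N + M) 1 (k + j - 1)))) {c..1}"
    using k l c by (simp, intro has_integral_sum has_integral_mult_right has_integral_beta_density) auto
  \<comment> \<open>The tails at \<open>1\<close> vanish because
    \<open>k + j - 1 < N + M\<close>.\<close>
  then have I: "((\<lambda>v. \<phi> v * D v) has_integral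
      (\<Sum>j = 0..l. zcoef N M k j * binom_tail (N + M) c (k + j - 1))) {c..1}"
    using k l by (simp add: binom_tail_at_1 atLeast0AtMost)
  have rI: "(\<lambda>v. r v * \<phi> v * D v) integrable_on S" if "S = {x..y}" for x y S
    unfolding that by (intro integrable_continuous_interval continuous_intros rcont \<phi>cont Dcont)
  have "(\<Sum>j = 0..l. zcoef N M k j * binom_tail (N + M) c (k + j - 1)) = integral {c..1} (\<lambda>v. \<phi> v * D v)"
    using I by (simp add: integral_unique)
  also have "\<dots> = integral {c..1} (\<lambda>v. r v * \<phi> v * D v)"
    by (intro integral_cong) (simp add: r)
  also have "\<dots> \<le> integral {0..1} (\<lambda>v. r v * \<phi> v * D v)"
    using c r(1) \<phi>0 D0 by (intro integral_subset_le rI[OF refl]) auto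
  also have "\<dots> = integral\<^sup>L \<nu> (\<lambda>v. r v * \<phi> v)"
    unfolding D_def
    by (rule expectation_from_moments[symmetric, OF assms(2) sets supp k(1) moments])
      (auto intro!: continuous_intros rcont \<phi>cont)
  also have "\<dots> \<le> integral\<^sup>L \<nu> (\<lambda>v. indicator {a<..} v * \<phi> v)"
  proof (rule integral_mono_AE)
    have ae: "AE v in \<nu>. norm (g v * \<phi> v) \<le> 1 * B" if "\<And>v. 0 \<le> g v \<and> g v \<le> 1" for g :: "real \<Rightarrow> real"
      using supp
    proof eventually_elim
      case (elim v)
      have "norm (g v) * norm (\<phi> v) \<le> 1 * B"
        using elim that[of v] B[of v] by (intro mult_mono) auto
      then show ?case by (simp add: abs_mult)
    qed
    show "integrable \<nu> (\<lambda>v. r v * \<phi> v)"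
      by (rule integrable_const_bound[OF ae])
        (use r in \<open>auto intro!: meas borel_measurable_continuous_onI continuous_intros rcont \<phi>cont\<close>)
    have "\<phi> \<in> borel_measurable borel" by (intro borel_measurable_continuous_onI \<phi>cont)
    then show "integrable \<nu> (\<lambda>v. indicator {a<..} v * \<phi> v)"
      by (intro integrable_const_bound[OF ae] meas) (auto split: split_indicator)
    show "AE v in \<nu>. r v * \<phi> v \<le> indicator {a<..} v * \<phi> v"
      using supp
    proof eventually_elim
      case (elim v)
      then show ?case using r(2,4)[of v] \<phi>0[of v]
        by (intro mult_right_mono) (auto split: split_indicator)
    qed
  qed
  finally show ?thesis .
qed

section \<open>The violation probability of the selection\<close>

lemma borel_measurable_peak:
  assumes "finite I" "\<And>i. i \<in> I \<Longrightarrow> (\<lambda>z. h z (w i z)) \<in> borel_measurable N"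
  shows "(\<lambda>z. peak ((\<lambda>i. w i z) ` I) (h z) :: real) \<in> borel_measurable N"
  using assms
proof (induction I)
  case empty
  then show ?case by (simp add: peak_def)
next
  case (insert a I)
  have "peak ((\<lambda>i. w i z) ` insert a I) (h z) = max (h z (w a z)) (peak ((\<lambda>i. w i z) ` I) (h z))" for z
    using insert.hyps(1) by (simp add: peak_def insert_commute[of 0])
  then show ?case using insert by simp
qed

text \<open>The induction generalizes \<open>g\<close>, because the level of a stage needs the score
  at every \<open>w i\<close> besides the one at \<open>g\<close>.\<close>

lemma borel_measurable_score:
  assumes "finite I" "\<And>i. i \<in> I \<Longrightarrow> w i \<in> borel_measurable N" "g \<in> borel_measurable N"
  shows "(\<lambda>z. score ((\<lambda>i. w i z) ` I) j (g z)) \<in> borel_measurable N"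
  using assms(3)
proof (induction j arbitrary: g)
  case 0
  then show ?case by simp
next
  case (Suc j)
  have "(\<lambda>z. level ((\<lambda>i. w i z) ` I) j) \<in> borel_measurable N"
    unfolding level_def using assms(1,2) Suc.IH by (intro borel_measurable_peak) auto
  then show ?case unfolding score_Suc using Suc by simp
qed

lemma borel_measurable_level:
  assumes "finite I" "\<And>i. i \<in> I \<Longrightarrow> w i \<in> borel_measurable N"
  shows "(\<lambda>z. level ((\<lambda>i. w i z) ` I) j) \<in> borel_measurable N"
  unfolding level_def using assms by (intro borel_measurable_peak borel_measurable_score) auto

lemma pred_exceeds:
  assumes "finite I" "\<And>i. i \<in> I \<Longrightarrow> w i \<in> borel_measurable N" "g \<in> borel_measurable N"
  shows "Measurable.pred N (\<lambda>z. exceeds k ((\<lambda>i. w i z) ` I) (g z))"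
proof -
  note [measurable] = borel_measurable_level[OF assms(1,2)] borel_measurable_score[OF assms]
  show ?thesis unfolding exceeds_def by measurable
qed

lemma sum_subsets_card_le:
  assumes "finite S"
  shows "(\<Sum>J | J \<subseteq> S \<and> card J \<le> l. g (card J)) = (\<Sum>j\<le>l. real (card S choose j) * g j)"
proof -
  have eq: "{J. J \<subseteq> S \<and> card J \<le> l} = (\<Union>j\<in>{..l}. {J. J \<subseteq> S \<and> card J = j})" by auto
  have "(\<Sum>J | J \<subseteq> S \<and> card J \<le> l. g (card J)) = (\<Sum>j\<le>l. \<Sum>J | J \<subseteq> S \<and> card J = j. g (card J))"
    unfolding eq using assms by (intro sum.UNION_disjoint) auto
  also have "\<dots> = (\<Sum>j\<le>l. real (card S choose j) * g j)"
    by (intro sum.cong refl) (simp add: n_subsets[OF assms])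
  finally show ?thesis .
qed

text \<open>Positivity of \<open>U\<close> keeps unselected scenarios at positive scores, the bound
  \<open>1\<close> makes the constraints convex, and atomlessness excludes ties almost
  surely.\<close>

locale atomless_scenarios = prob_space P
  for P :: "'s measure" +
  fixes U :: "'s \<Rightarrow> real" and k :: nat
  assumes U_measurable [measurable]: "U \<in> borel_measurable P"
    and U_range: "\<And>\<delta>. \<delta> \<in> space P \<Longrightarrow> 0 < U \<delta> \<and> U \<delta> < 1"
    and U_atomless: "\<And>c. AE \<delta> in P. U \<delta> \<noteq> c"
begin

abbreviation Prod :: "nat set \<Rightarrow> (nat \<Rightarrow> 's) measure" where
  "Prod A \<equiv> Pi\<^sub>M A (\<lambda>_. P)"

definition vals :: "(nat \<Rightarrow> 's) \<Rightarrow> nat set \<Rightarrow> real set" where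
  "vals \<omega> I = (\<lambda>i. U (\<omega> i)) ` I"

definition excess_prob :: "real set \<Rightarrow> real" where
  "excess_prob W = measure P {\<delta> \<in> space P. exceeds k W (U \<delta>)}"

sublocale PS: product_sigma_finite "\<lambda>_::nat. P"
  by standard

lemma prob_space_Prod: "prob_space (Prod A)"
  by (intro prob_space_PiM prob_space_axioms)

lemma U_component: "i \<in> A \<Longrightarrow> (\<lambda>\<omega>. U (\<omega> i)) \<in> borel_measurable (Prod A)"
  by measurable

lemma finite_vals [simp]: "finite I \<Longrightarrow> finite (vals \<omega> I)"
  by (simp add: vals_def)

lemma vals_range: "\<omega> \<in> space (Prod A) \<Longrightarrow> I \<subseteq> A \<Longrightarrow> u \<in> vals \<omega> I \<Longrightarrow> 0 < u \<and> u < 1"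
  using U_range by (auto simp: vals_def space_PiM)

lemma pred_exceeds_U [measurable]:
  "finite W \<Longrightarrow> Measurable.pred P (\<lambda>\<delta>. exceeds k W (U \<delta>))"
  using pred_exceeds[of W "\<lambda>u _. u" P U k] by simp

lemma pred_exceeds_vals:
  "finite I \<Longrightarrow> I \<subseteq> A \<Longrightarrow> i \<in> A \<Longrightarrow> Measurable.pred (Prod A) (\<lambda>\<omega>. exceeds k (vals \<omega> I) (U (\<omega> i)))"
  unfolding vals_def by (intro pred_exceeds U_component) auto

lemma excess_prob_bounds: "0 \<le> excess_prob W" "excess_prob W \<le> 1"
  by (simp_all add: excess_prob_def)

lemma emeasure_exceeds:
  assumes "finite W"
  shows "emeasure P {\<delta> \<in> space P. exceeds k W (U \<delta>)} = ennreal (excess_prob W)"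
    "emeasure P {\<delta> \<in> space P. \<not> exceeds k W (U \<delta>)} = ennreal (1 - excess_prob W)"
proof -
  show "emeasure P {\<delta> \<in> space P. exceeds k W (U \<delta>)} = ennreal (excess_prob W)"
    by (simp add: excess_prob_def emeasure_eq_measure)
  have "{\<delta> \<in> space P. exceeds k W (U \<delta>)} \<in> events" using assms by measurable
  from prob_compl[OF this]
  have "prob {\<delta> \<in> space P. \<not> exceeds k W (U \<delta>)} = 1 - excess_prob W"
    unfolding excess_prob_def by (simp add: set_diff_eq[symmetric] set_diff_eq Collect_conj_eq[symmetric] cong: conj_cong)
  then show "emeasure P {\<delta> \<in> space P. \<not> exceeds k W (U \<delta>)} = ennreal (1 - excess_prob W)"
    by (simp add: emeasure_eq_measure)
qed

text \<open>The values are measures of the sections of a single measurable set in the product with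
  \<open>P\<close>.\<close>

lemma excess_prob_measurable:
  assumes "finite I" "I \<subseteq> A"
  shows "(\<lambda>\<omega>. excess_prob (vals \<omega> I)) \<in> borel_measurable (Prod A)"
proof -
  have "Measurable.pred (Prod A \<Otimes>\<^sub>M P) (\<lambda>z. exceeds k ((\<lambda>i. U (fst z i)) ` I) (U (snd z)))"
    using assms(2) by (intro pred_exceeds assms(1)) auto
  then have "{z \<in> space (Prod A \<Otimes>\<^sub>M P). snd z \<in> {\<delta> \<in> space P. exceeds k (vals (fst z) I) (U \<delta>)}}
      \<in> sets (Prod A \<Otimes>\<^sub>M P)"
    by (simp add: vals_def pred_def space_pair_measure conj_commute cong: conj_cong) (simp add: mem_Times_iff cong: conj_cong)
  then show ?thesis
    unfolding excess_prob_def measure_def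
    by (intro borel_measurable_enn2real measurable_emeasure) auto
qed

text \<open>The score is built without the values at \<open>a\<close> and \<open>b\<close>, so it
  does not depend on coordinate \<open>a\<close>. With the other coordinates fixed, a tie forces
  \<open>U (\<omega> a)\<close> into the finite root set of a nonconstant polynomial, and each root
  has probability \<open>0\<close>.\<close>

lemma AE_no_tie:
  assumes A: "finite A" and I: "I \<subseteq> A" and ab: "a \<in> I" "b \<in> I" "a \<noteq> b"
  shows "AE \<omega> in Prod A. score (vals \<omega> (I - {a, b})) j (U (\<omega> a)) \<noteq> score (vals \<omega> (I - {a, b})) j (U (\<omega> b))"
proof -
  define T where "T = {\<omega> \<in> space (Prod A).
    score (vals \<omega> (I - {a, b})) j (U (\<omega> a)) = score (vals \<omega> (I - {a, b})) j (U (\<omega> b))}"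
  have fI: "finite (I - {a, b})" using A I finite_subset by blast
  have [measurable]: "(\<lambda>\<omega>. score (vals \<omega> (I - {a, b})) j (U (\<omega> i))) \<in> borel_measurable (Prod A)" if "i \<in> A" for i
    unfolding vals_def using that I by (intro borel_measurable_score fI U_component) auto
  have "a \<in> A" "b \<in> A" using ab I by auto
  then have T: "T \<in> sets (Prod A)" unfolding T_def by measurable
  define A' where "A' = A - {a}"
  have A': "A = insert a A'" "finite A'" "a \<notin> A'" using \<open>a \<in> A\<close> A by (auto simp: A'_def)
  have "emeasure (Prod A) T = (\<integral>\<^sup>+\<omega>. indicator T \<omega> \<partial>Prod A)"
    using T by simp
  also have "\<dots> = (\<integral>\<^sup>+x. (\<integral>\<^sup>+y. indicator T (x(a := y)) \<partial>P) \<partial>Prod A')"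
    using T unfolding A'(1) by (intro PS.product_nn_integral_insert A') simp
  also have "\<dots> = (\<integral>\<^sup>+x. 0 \<partial>Prod A')"
  proof (intro nn_integral_cong)
    fix x assume "x \<in> space (Prod A')"
    define W where "W = vals x (I - {a, b})"
    define c where "c = score W j (U (x b))"
    have "finite {u. score W j u = c}" by (rule finite_score_level_set)
    then have "AE y in P. \<forall>u\<in>{u. score W j u = c}. U y \<noteq> u"
      by (intro AE_finite_allI U_atomless)
    moreover have "vals (x(a := y)) (I - {a, b}) = W" for y
      unfolding vals_def W_def by (intro image_cong) auto
    ultimately have "AE y in P. indicator T (x(a := y)) = (0::ennreal)"
      using ab(3) by (auto simp: T_def c_def split: split_indicator)
    then show "(\<integral>\<^sup>+y. indicator T (x(a := y)) \<partial>P) = 0"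
      using nn_integral_cong_AE[of "\<lambda>y. indicator T (x(a := y))" "\<lambda>_. 0" P] by simp
  qed
  finally have "emeasure (Prod A) T = 0" by simp
  then have "T \<in> null_sets (Prod A)" using T by (simp add: null_sets_def)
  then have "AE \<omega> in Prod A. \<omega> \<notin> T" by (rule AE_not_in)
  then show ?thesis
    using AE_space by eventually_elim (simp add: T_def)
qed

definition generic :: "(nat \<Rightarrow> 's) \<Rightarrow> nat set \<Rightarrow> bool" where
  "generic \<omega> I \<longleftrightarrow> inj_on (\<lambda>i. U (\<omega> i)) I \<and> tie_free (vals \<omega> I)"

text \<open>By \<open>tie_persists\<close>, a nonzero tie would already be a tie for the scores
  built without the two tied values; these are countably many null events.\<close>

lemma AE_generic:
  assumes A: "finite A" and I: "I \<subseteq> A"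
  shows "AE \<omega> in Prod A. generic \<omega> I"
proof -
  have fI: "finite I" using A I finite_subset by blast
  have "AE \<omega> in Prod A. \<forall>j::nat. \<forall>a\<in>I. \<forall>b\<in>I. a \<noteq> b \<longrightarrow>
      score (vals \<omega> (I - {a, b})) j (U (\<omega> a)) \<noteq> score (vals \<omega> (I - {a, b})) j (U (\<omega> b))"
    unfolding AE_all_countable
  proof (intro allI AE_finite_allI fI)
    fix j :: nat and a b assume "a \<in> I" "b \<in> I"
    then show "AE \<omega> in Prod A. a \<noteq> b \<longrightarrow>
        score (vals \<omega> (I - {a, b})) j (U (\<omega> a)) \<noteq> score (vals \<omega> (I - {a, b})) j (U (\<omega> b))"
      using AE_no_tie[OF A I] by (cases "a = b") auto
  qed
  then show ?thesis
  proof eventually_elim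
    case (elim \<omega>)
    \<comment> \<open>The score at stage \<open>0\<close> is the value itself, so absence of ties
      there is injectivity.\<close>
    have inj: "inj_on (\<lambda>i. U (\<omega> i)) I"
      using elim[rule_format, of _ _ 0] by (auto intro!: inj_onI)
    have "score (vals \<omega> I) j (U (\<omega> a)) = 0"
      if "a \<in> I" "b \<in> I" "U (\<omega> a) \<noteq> U (\<omega> b)" "score (vals \<omega> I) j (U (\<omega> a)) = score (vals \<omega> I) j (U (\<omega> b))"
      for a b j
    proof (rule ccontr)
      assume nz: "score (vals \<omega> I) j (U (\<omega> a)) \<noteq> 0"
      have eq: "vals \<omega> (I - {a, b}) = vals \<omega> I - {U (\<omega> a), U (\<omega> b)}"
        unfolding vals_def using inj_on_image_set_diff[OF inj, of I "{a, b}"] that by auto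
      have "U (\<omega> a) \<in> vals \<omega> I" "U (\<omega> b) \<in> vals \<omega> I" using that by (auto simp: vals_def)
      from tie_persists[OF finite_vals[OF fI] this that(4) nz] elim[rule_format, of a b j] that eq
      show False by auto
    qed
    moreover have "\<exists>a\<in>I. u = U (\<omega> a)" if "u \<in> vals \<omega> I" for u
      using that by (auto simp: vals_def)
    ultimately have "tie_free (vals \<omega> I)"
      unfolding tie_free_def by metis
    with inj show ?case by (simp add: generic_def)
  qed
qed

definition pick_idx :: "(nat \<Rightarrow> 's) \<Rightarrow> nat set \<Rightarrow> nat set" where
  "pick_idx \<omega> I = {i \<in> I. U (\<omega> i) \<in> picks k (vals \<omega> I)}"

lemma vals_pick_idx: "vals \<omega> (pick_idx \<omega> I) = picks k (vals \<omega> I)"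
  using picks_subset[of k "vals \<omega> I"] by (auto simp: vals_def pick_idx_def)

lemma card_pick_idx:
  assumes \<omega>: "\<omega> \<in> space (Prod A)" and I: "finite I" "I \<subseteq> A" "k \<le> card I" and gen: "generic \<omega> I"
  shows "card (pick_idx \<omega> I) = k"
proof -
  have inj: "inj_on (\<lambda>i. U (\<omega> i)) I" using gen by (simp add: generic_def)
  have "inj_on (\<lambda>i. U (\<omega> i)) (pick_idx \<omega> I)"
    by (rule inj_on_subset[OF inj]) (auto simp: pick_idx_def)
  then have "card (pick_idx \<omega> I) = card (vals \<omega> (pick_idx \<omega> I))"
    unfolding vals_def by (rule card_image[symmetric])
  also have "\<dots> = k" unfolding vals_pick_idx
  proof (rule card_picks)
    show "k \<le> card (vals \<omega> I)" using I(3) card_image[OF inj] by (simp add: vals_def)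
    show "\<forall>u\<in>vals \<omega> I. 0 < u" using vals_range[OF \<omega> I(2)] by blast
  qed (use I gen in \<open>auto simp: generic_def\<close>)
  finally show ?thesis .
qed

text \<open>Index form of \<open>picks_unique\<close> and \<open>not_exceeds_picks\<close>;
  injectivity makes index sets and value sets correspond.\<close>

lemma not_exceeds_iff_pick_idx:
  assumes \<omega>: "\<omega> \<in> space (Prod A)" and I: "finite I" "I \<subseteq> A" "k \<le> card I" and gen: "generic \<omega> I"
    and K: "K \<subseteq> I" "card K = k"
  shows "(\<forall>i\<in>I - K. \<not> exceeds k (vals \<omega> K) (U (\<omega> i))) \<longleftrightarrow> K = pick_idx \<omega> I"
proof
  have inj: "inj_on (\<lambda>i. U (\<omega> i)) I" using gen by (simp add: generic_def)
  assume nex: "\<forall>i\<in>I - K. \<not> exceeds k (vals \<omega> K) (U (\<omega> i))"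
  have "vals \<omega> K = picks k (vals \<omega> I)"
  proof (rule picks_unique)
    show "card (vals \<omega> K) = k"
      using K card_image[OF inj_on_subset[OF inj K(1)]] by (simp add: vals_def)
    show "\<forall>u\<in>vals \<omega> I. 0 < u" using vals_range[OF \<omega> I(2)] by blast
    show "\<And>u. u \<in> vals \<omega> I - vals \<omega> K \<Longrightarrow> \<not> exceeds k (vals \<omega> K) u"
      using nex by (auto simp: vals_def)
  qed (use I K gen in \<open>auto simp: generic_def vals_def\<close>)
  then have "K \<subseteq> pick_idx \<omega> I" using K(1) by (auto simp: pick_idx_def vals_def)
  moreover have "finite (pick_idx \<omega> I)" using I(1) by (simp add: pick_idx_def)
  ultimately show "K = pick_idx \<omega> I"
    using card_pick_idx[OF \<omega> I gen] K(2) by (intro card_subset_eq) auto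
next
  assume "K = pick_idx \<omega> I"
  then show "\<forall>i\<in>I - K. \<not> exceeds k (vals \<omega> K) (U (\<omega> i))"
    using not_exceeds_picks[of "vals \<omega> I" _ k] I(1) by (auto simp: vals_pick_idx) (auto simp: vals_def)
qed

section \<open>The law of the violation probability\<close>

definition excess_law :: "real measure" where
  "excess_law = distr (Prod {..<k}) borel (\<lambda>\<omega>. excess_prob (vals \<omega> {..<k}))"

lemma sets_excess_law: "sets excess_law = sets borel"
  by (simp add: excess_law_def)

lemma prob_space_excess_law: "prob_space excess_law"
  unfolding excess_law_def
  by (intro prob_space.prob_space_distr prob_space_Prod excess_prob_measurable) auto

lemma AE_excess_law: "AE v in excess_law. 0 \<le> v \<and> v \<le> 1"
  unfolding excess_law_def
  by (subst AE_distr_iff[OF excess_prob_measurable]) (auto simp: excess_prob_bounds)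

text \<open>Exchangeability: transport along a bijection of index sets preserves the product
  measure, so every \<open>k\<close>-subset yields the same law.\<close>

lemma nn_integral_reindex:
  assumes I: "finite I" "card I = k" and \<phi>: "\<phi> \<in> borel_measurable borel"
  shows "(\<integral>\<^sup>+\<omega>. \<phi> (excess_prob (vals \<omega> I)) \<partial>Prod I) = (\<integral>\<^sup>+v. \<phi> v \<partial>excess_law)"
proof -
  obtain f where f: "bij_betw f {..<k} I" using ex_bij_betw_nat_finite[OF I(1)] I(2) by (auto simp: atLeast0LessThan)
  then have f': "inj_on f {..<k}" "f \<in> {..<k} \<rightarrow> I" "f ` {..<k} = I"
    by (auto simp: bij_betw_def)
  let ?t = "\<lambda>\<omega>. \<lambda>n\<in>{..<k}. \<omega> (f n)"
  have t: "?t \<in> Prod I \<rightarrow>\<^sub>M Prod {..<k}"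
    using f'(2) by (intro measurable_restrict measurable_component_singleton) auto
  have D: "distr (Prod I) (Prod {..<k}) ?t = Prod {..<k}"
    using distr_PiM_reindex[OF _ f'(1,2), of "\<lambda>_. P"] prob_space_axioms by simp
  have v: "vals (?t \<omega>) {..<k} = vals \<omega> I" for \<omega>
    unfolding vals_def f'(3)[symmetric] by (auto simp: image_image)
  have [measurable]: "(\<lambda>\<omega>. \<phi> (excess_prob (vals \<omega> {..<k}))) \<in> borel_measurable (Prod {..<k})"
    by (rule measurable_compose[OF excess_prob_measurable \<phi>]) auto
  have "(\<integral>\<^sup>+v. \<phi> v \<partial>excess_law) = (\<integral>\<^sup>+\<omega>. \<phi> (excess_prob (vals \<omega> {..<k})) \<partial>Prod {..<k})"
    unfolding excess_law_def by (intro nn_integral_distr excess_prob_measurable) (auto simp: \<phi>)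
  also have "\<dots> = (\<integral>\<^sup>+\<omega>. \<phi> (excess_prob (vals \<omega> {..<k})) \<partial>distr (Prod I) (Prod {..<k}) ?t)"
    by (simp add: D)
  also have "\<dots> = (\<integral>\<^sup>+\<omega>. \<phi> (excess_prob (vals \<omega> I)) \<partial>Prod I)"
    by (subst nn_integral_distr[OF t]) (simp_all add: v)
  finally show ?thesis by simp
qed

lemma pred_excess_pattern:
  assumes "finite A" "I \<subseteq> A" "J \<subseteq> A" "K \<subseteq> A" "S \<in> sets borel"
  shows "Measurable.pred (Prod A) (\<lambda>\<omega>. excess_prob (vals \<omega> I) \<in> S
      \<and> (\<forall>i\<in>J. exceeds k (vals \<omega> I) (U (\<omega> i))) \<and> (\<forall>i\<in>K. \<not> exceeds k (vals \<omega> I) (U (\<omega> i))))"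
proof -
  have fin: "finite I" "finite J" "finite K" using assms finite_subset by blast+
  note [measurable] = excess_prob_measurable[OF fin(1) assms(2)] assms(5)
  have [measurable]: "Measurable.pred (Prod A) (\<lambda>\<omega>. exceeds k (vals \<omega> I) (U (\<omega> i)))" if "i \<in> A" for i
    by (rule pred_exceeds_vals[OF fin(1) assms(2) that])
  have "Measurable.pred (Prod A) (\<lambda>\<omega>. \<forall>i\<in>J. exceeds k (vals \<omega> I) (U (\<omega> i)))"
    "Measurable.pred (Prod A) (\<lambda>\<omega>. \<forall>i\<in>K. \<not> exceeds k (vals \<omega> I) (U (\<omega> i)))"
    using fin assms(3,4) by (auto intro!: pred_intros_finite pred_intros_logic)
  then show ?thesis by measurable
qed

text \<open>
  Given the scenarios in \<open>I\<close>, the others exceed the levels independently with probability \<open>v\<close>.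
\<close>

lemma measure_excess_pattern:
  assumes A: "finite A" and I: "I \<subseteq> A" "card I = k" and J: "J \<subseteq> A - I" and S: "S \<in> sets borel"
  shows "measure (Prod A) {\<omega> \<in> space (Prod A). excess_prob (vals \<omega> I) \<in> S
      \<and> (\<forall>i\<in>J. exceeds k (vals \<omega> I) (U (\<omega> i))) \<and> (\<forall>i\<in>A - I - J. \<not> exceeds k (vals \<omega> I) (U (\<omega> i)))}
    = integral\<^sup>L excess_law (\<lambda>v. indicator S v * (v ^ card J * (1 - v) ^ card (A - I - J)))"
    (is "measure _ ?R = _")
proof -
  define K where "K = A - I"
  have fin: "finite I" "finite K" "finite J" "I \<inter> K = {}" "A = I \<union> K"
    using A I J finite_subset[of I A] finite_subset[of J A] by (auto simp: K_def)
  \<comment> \<open>\<open>h W i\<close> is the indicator that scenario \<open>i\<close> behaves as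
    \<open>J\<close> prescribes. The event thus becomes a product over \<open>K\<close>, whose
    factors integrate separately once the scenarios in \<open>I\<close> are fixed.\<close>
  define h where "h W i \<delta> = (indicator (if i \<in> J then {\<delta> \<in> space P. exceeds k W (U \<delta>)}
    else {\<delta> \<in> space P. \<not> exceeds k W (U \<delta>)}) \<delta> :: ennreal)" for W i \<delta>
  have R: "?R \<in> sets (Prod A)"
    using pred_excess_pattern[OF A I(1) _ _ S, of J "A - I - J"] J by (auto simp: pred_def)
  have ind: "indicator ?R \<omega> = indicator S (excess_prob (vals \<omega> I)) * (\<Prod>i\<in>K. h (vals \<omega> I) i (\<omega> i))"
    if \<omega>: "\<omega> \<in> space (Prod A)" for \<omega>
  proof -
    have sp: "\<omega> i \<in> space P" if "i \<in> K" for i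
      using \<omega> that by (auto simp: space_PiM K_def)
    have h: "h (vals \<omega> I) i (\<omega> i) = (if exceeds k (vals \<omega> I) (U (\<omega> i)) = (i \<in> J) then 1 else 0)"
      if "i \<in> K" for i using sp[OF that] by (auto simp: h_def)
    have "(\<Prod>i\<in>K. h (vals \<omega> I) i (\<omega> i))
        = (if \<forall>i\<in>K. exceeds k (vals \<omega> I) (U (\<omega> i)) = (i \<in> J) then 1 else 0)"
    proof (cases "\<forall>i\<in>K. exceeds k (vals \<omega> I) (U (\<omega> i)) = (i \<in> J)")
      case True
      then show ?thesis using h by simp
    next
      case False
      then show ?thesis using h fin(2) by (auto simp: prod_zero_iff)
    qed
    moreover have "\<omega> \<in> ?R \<longleftrightarrow> excess_prob (vals \<omega> I) \<in> S \<and>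
        (\<forall>i\<in>K. exceeds k (vals \<omega> I) (U (\<omega> i)) = (i \<in> J))"
      using \<omega> J by (auto simp: K_def)
    ultimately show ?thesis by (auto split: split_indicator)
  qed
  have hm: "h W i \<in> borel_measurable P" if "finite W" for W i
    unfolding h_def[abs_def] using that by (auto intro!: borel_measurable_indicator)
  have meas: "(\<lambda>v. indicator S v * (v ^ card J * (1 - v) ^ card (K - J)) :: real) \<in> borel_measurable borel"
    using S by (intro borel_measurable_times borel_measurable_indicator borel_measurable_power
        borel_measurable_diff) auto
  have "emeasure (Prod A) ?R = (\<integral>\<^sup>+\<omega>. indicator ?R \<omega> \<partial>Prod (I \<union> K))"
    using R fin(5) by simp
  also have "\<dots> = (\<integral>\<^sup>+x. (\<integral>\<^sup>+y. indicator ?R (merge I K (x, y)) \<partial>Prod K) \<partial>Prod I)"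
    using R fin by (intro PS.product_nn_integral_fold) auto
  also have "\<dots> = (\<integral>\<^sup>+x. (\<integral>\<^sup>+y. indicator S (excess_prob (vals x I)) *
      (\<Prod>i\<in>K. h (vals x I) i (y i)) \<partial>Prod K) \<partial>Prod I)"
  proof (intro nn_integral_cong)
    fix x y assume xy: "x \<in> space (Prod I)" "y \<in> space (Prod K)"
    have "merge I K (x, y) \<in> space (Prod A)"
      unfolding fin(5) using xy by (auto simp: space_PiM PiE_iff merge_def extensional_def)
    moreover have "vals (merge I K (x, y)) I = vals x I"
      unfolding vals_def by (intro image_cong) (auto simp: merge_def)
    moreover have "(\<Prod>i\<in>K. h W i (merge I K (x, y) i)) = (\<Prod>i\<in>K. h W i (y i))" for W
      using fin(4) by (intro prod.cong) (auto simp: merge_def)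
    ultimately show "indicator ?R (merge I K (x, y))
        = indicator S (excess_prob (vals x I)) * (\<Prod>i\<in>K. h (vals x I) i (y i))"
      using ind by simp
  qed
  also have "\<dots> = (\<integral>\<^sup>+x. indicator S (excess_prob (vals x I)) *
      (ennreal (excess_prob (vals x I)) ^ card J * ennreal (1 - excess_prob (vals x I)) ^ card (K - J)) \<partial>Prod I)"
  proof (intro nn_integral_cong)
    fix x
    let ?v = "excess_prob (vals x I)"
    have "(\<integral>\<^sup>+y. (\<Prod>i\<in>K. h (vals x I) i (y i)) \<partial>Prod K) = (\<Prod>i\<in>K. integral\<^sup>N P (h (vals x I) i))"
      using fin by (intro PS.product_nn_integral_prod hm) auto
    also have "\<dots> = (\<Prod>i\<in>K. if i \<in> J then ennreal ?v else ennreal (1 - ?v))"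
      unfolding h_def[abs_def] using fin(1) by (intro prod.cong refl) (auto simp: emeasure_exceeds)
    also have "\<dots> = ennreal ?v ^ card (K \<inter> J) * ennreal (1 - ?v) ^ card (K - J)"
      by (simp add: prod.If_cases[OF fin(2)] Diff_eq)
    also have "K \<inter> J = J" using J by (auto simp: K_def)
    finally have E: "(\<integral>\<^sup>+y. (\<Prod>i\<in>K. h (vals x I) i (y i)) \<partial>Prod K)
        = ennreal ?v ^ card J * ennreal (1 - ?v) ^ card (K - J)" .
    have "(\<lambda>y. \<Prod>i\<in>K. h (vals x I) i (y i)) \<in> borel_measurable (Prod K)"
      using fin(1) by (intro borel_measurable_prod_ennreal measurable_compose[OF _ hm]) auto
    then show "(\<integral>\<^sup>+y. indicator S ?v * (\<Prod>i\<in>K. h (vals x I) i (y i)) \<partial>Prod K)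
        = indicator S ?v * (ennreal ?v ^ card J * ennreal (1 - ?v) ^ card (K - J))"
      by (simp add: nn_integral_cmult E)
  qed
  also have "\<dots> = (\<integral>\<^sup>+x. ennreal (indicator S (excess_prob (vals x I)) *
      (excess_prob (vals x I) ^ card J * (1 - excess_prob (vals x I)) ^ card (K - J))) \<partial>Prod I)"
    using excess_prob_bounds
    by (intro nn_integral_cong) (auto simp: ennreal_mult' ennreal_power split: split_indicator)
  also have "\<dots> = (\<integral>\<^sup>+v. ennreal (indicator S v * (v ^ card J * (1 - v) ^ card (K - J))) \<partial>excess_law)"
    by (intro nn_integral_reindex fin I measurable_compose[OF meas measurable_ennreal])
  finally have "measure (Prod A) ?R
      = enn2real (\<integral>\<^sup>+v. ennreal (indicator S v * (v ^ card J * (1 - v) ^ card (K - J))) \<partial>excess_law)"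
    by (simp add: measure_def)
  also have "\<dots> = integral\<^sup>L excess_law (\<lambda>v. indicator S v * (v ^ card J * (1 - v) ^ card (K - J)))"
  proof (rule integral_eq_nn_integral[symmetric])
    show "(\<lambda>v. indicator S v * (v ^ card J * (1 - v) ^ card (K - J))) \<in> borel_measurable excess_law"
      using meas by (subst measurable_cong_sets[OF sets_excess_law refl])
    show "AE v in excess_law. 0 \<le> indicator S v * (v ^ card J * (1 - v) ^ card (K - J))"
      using AE_excess_law by eventually_elim auto
  qed
  finally show ?thesis by (simp add: K_def)
qed

text \<open>Over all \<open>k\<close>-subsets \<open>I\<close> of \<open>m + k\<close> scenarios,
  the events \<open>R I\<close> almost surely partition the space. Each has the desired moment as
  its probability, so their number times this moment is \<open>1\<close>.\<close>

lemma moments_excess_law: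
  "integral\<^sup>L excess_law (\<lambda>v. (1 - v) ^ m) = 1 / real ((m + k) choose k)"
proof -
  interpret PP: prob_space "Prod {..<m + k}" by (rule prob_space_Prod)
  define A where "A = {..<m + k}"
  define F where "F = {I. I \<subseteq> A \<and> card I = k}"
  define R where "R I = {\<omega> \<in> space (Prod A). \<forall>i\<in>A - I. \<not> exceeds k (vals \<omega> I) (U (\<omega> i))}" for I
  have A: "finite A" "card A = m + k" by (simp_all add: A_def)
  have F: "finite F" "card F = (m + k) choose k" using A n_subsets[of A k] by (auto simp: F_def)
  have mR: "measure (Prod A) (R I) = integral\<^sup>L excess_law (\<lambda>v. (1 - v) ^ m)" if I: "I \<in> F" for I
  proof -
    have "I \<subseteq> A" "card I = k" "card (A - I) = m"
      using I A by (auto simp: F_def card_Diff_subset finite_subset)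
    then show ?thesis
      using measure_excess_pattern[of A I "{}" UNIV] A(1) by (simp add: R_def)
  qed
  have R: "R I \<in> sets (Prod A)" if "I \<in> F" for I
    using pred_excess_pattern[of A I "{}" "A - I" UNIV] A that by (simp add: R_def F_def pred_def)
  have "AE \<omega> in Prod A. (\<Sum>I\<in>F. indicator (R I) \<omega>) = (1::real)"
    using AE_generic[OF A(1) order_refl] AE_space
  proof eventually_elim
    case (elim \<omega>)
    have card: "card (pick_idx \<omega> A) = k"
      using card_pick_idx[OF elim(2) A(1) order_refl _ elim(1)] A by simp
    have "indicator (R I) \<omega> = (if I = pick_idx \<omega> A then 1 else 0 :: real)" if "I \<in> F" for I
      using not_exceeds_iff_pick_idx[OF elim(2) A(1) order_refl _ elim(1), of I] that A elim(2)
      by (auto simp: R_def F_def)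
    then have "(\<Sum>I\<in>F. indicator (R I) \<omega>) = (\<Sum>I\<in>F. if I = pick_idx \<omega> A then 1 else 0 :: real)"
      by (intro sum.cong) auto
    also have "\<dots> = 1" using F card by (auto simp: F_def pick_idx_def)
    finally show ?case .
  qed
  then have "integral\<^sup>L (Prod A) (\<lambda>\<omega>. \<Sum>I\<in>F. indicator (R I) \<omega>) = integral\<^sup>L (Prod A) (\<lambda>_. 1::real)"
    using R by (intro integral_cong_AE) auto
  moreover have "integral\<^sup>L (Prod A) (\<lambda>\<omega>. \<Sum>I\<in>F. indicator (R I) \<omega> :: real) = (\<Sum>I\<in>F. measure (Prod A) (R I))"
    using R by (subst Bochner_Integration.integral_sum) (auto simp: A_def PP.emeasure_eq_measure)
  ultimately have "real ((m + k) choose k) * integral\<^sup>L excess_law (\<lambda>v. (1 - v) ^ m) = 1"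
    using mR F by (simp add: A_def PP.prob_space)
  then show ?thesis by (simp add: field_simps)
qed

text \<open>The event is decomposed by the selected design scenarios \<open>I\<close> and the
  violated validation scenarios \<open>J\<close>. Each piece is an instance of
  \<open>measure_excess_pattern\<close> whose probability depends on \<open>card J\<close> only.
  Leaving \<open>B\<close> abstract separates this count from the thresholds
  \<open>\<epsilon>\<close>.\<close>

lemma prob_excess_ge:
  assumes k: "1 \<le> k" "k < N" and l: "l \<le> M" and c: "0 \<le> a" "a < c" "c \<le> 1"
    and B: "B \<in> sets (Prod {..<N + M})"
    and BI: "\<And>\<omega>. \<omega> \<in> space (Prod {..<N + M}) \<Longrightarrow> generic \<omega> {..<N} \<Longrightarrow>
      a < excess_prob (vals \<omega> {..<N}) \<Longrightarrow>
      card {i \<in> {N..<N + M}. exceeds k (vals \<omega> {..<N}) (U (\<omega> i))} \<le> l \<Longrightarrow> \<omega> \<in> B"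
  shows "(\<Sum>j = 0..l. zcoef N M k j * binom_tail (N + M) c (k + j - 1)) \<le> measure (Prod {..<N + M}) B"
proof -
  define A where "A = {..<N + M}"
  interpret PP: prob_space "Prod A" by (rule prob_space_Prod)
  define F where "F = {I. I \<subseteq> {..<N} \<and> card I = k}"
  define G where "G = {J. J \<subseteq> {N..<N + M} \<and> card J \<le> l}"
  define R where "R I J = {\<omega> \<in> space (Prod A). excess_prob (vals \<omega> I) \<in> {a<..}
      \<and> (\<forall>i\<in>J. exceeds k (vals \<omega> I) (U (\<omega> i))) \<and> (\<forall>i\<in>A - I - J. \<not> exceeds k (vals \<omega> I) (U (\<omega> i)))}" for I J
  have A: "finite A" "card A = N + M" "{..<N} \<subseteq> A" by (auto simp: A_def)
  have F: "finite F" "card F = N choose k" using n_subsets[of "{..<N}" k] by (auto simp: F_def)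
  have G: "finite G" by (simp add: G_def)
  define \<psi> where "\<psi> j = integral\<^sup>L excess_law (\<lambda>v. indicator {a<..} v * (v ^ j * (1 - v) ^ (N + M - k - j)))" for j
  have sub: "I \<subseteq> A" "J \<subseteq> A - I" "card I = k" "card (A - I - J) = N + M - k - card J"
    if "I \<in> F" "J \<in> G" for I J
  proof -
    have "I \<subseteq> {..<N}" "J \<subseteq> {N..<N + M}" using that by (auto simp: F_def G_def)
    then show IJ: "I \<subseteq> A" "J \<subseteq> A - I" "card I = k"
      using that by (fastforce simp: A_def F_def)+
    then show "card (A - I - J) = N + M - k - card J"
      using A finite_subset[of _ A] finite_subset[of J "A - I"] by (simp add: card_Diff_subset)
  qed
  have R: "R I J \<in> sets (Prod A)" if "I \<in> F" "J \<in> G" for I J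
    using pred_excess_pattern[OF A(1) sub(1)[OF that], of J "A - I - J" "{a<..}"] sub[OF that]
    by (auto simp: R_def pred_def)
  have int: "integrable (Prod A) (indicator (R I J) :: _ \<Rightarrow> real)" if "I \<in> F" "J \<in> G" for I J
    using R[OF that] by (intro integrable_real_indicator) (auto simp: PP.emeasure_eq_measure)
  have mR: "measure (Prod A) (R I J) = \<psi> (card J)" if "I \<in> F" "J \<in> G" for I J
    using measure_excess_pattern[OF A(1) sub(1,3,2)[OF that], of "{a<..}"] sub(4)[OF that]
    by (simp add: R_def \<psi>_def)
  have "AE \<omega> in Prod A. (\<Sum>I\<in>F. \<Sum>J\<in>G. indicator (R I J) \<omega>) \<le> (indicator B \<omega> :: real)"
    using AE_generic[OF A(1,3)] AE_space
  proof eventually_elim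
    case (elim \<omega>)
    define I0 where "I0 = pick_idx \<omega> {..<N}"
    define J0 where "J0 = {i \<in> {N..<N + M}. exceeds k (vals \<omega> I0) (U (\<omega> i))}"
    \<comment> \<open>At most one pair contributes: the pattern forces \<open>I\<close> to be the
      selection and \<open>J\<close> to be the set of violated validation scenarios.\<close>
    have IJ: "I = I0 \<and> J = J0 \<and> \<omega> \<in> B" if "I \<in> F" "J \<in> G" "\<omega> \<in> R I J" for I J
    proof -
      have "{..<N} - I \<subseteq> A - I - J" using that by (auto simp: G_def A_def)
      then have "\<forall>i\<in>{..<N} - I. \<not> exceeds k (vals \<omega> I) (U (\<omega> i))"
        using that(3) by (auto simp: R_def)
      then have I: "I = I0"
        using not_exceeds_iff_pick_idx[OF elim(2) _ A(3) _ elim(1), of I] that(1) k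
        by (auto simp: F_def I0_def)
      moreover have J: "J = J0"
        using that k by (auto simp: J0_def R_def G_def A_def F_def I)
      moreover have "\<omega> \<in> B"
      proof (rule BI)
        \<comment> \<open>The selection and the full design set have equal levels, hence the same
          violations and the same violation probability.\<close>
        have lev: "level (vals \<omega> I0) j = level (vals \<omega> {..<N}) j" if "j < k" for j
          unfolding I0_def vals_pick_idx
          by (rule levels_picks) (auto simp: that picks_subset)
        then have ex: "exceeds k (vals \<omega> I0) u = exceeds k (vals \<omega> {..<N}) u" for u
          by (rule exceeds_cong)
        show "a < excess_prob (vals \<omega> {..<N})"
          using that(3) by (simp add: R_def I excess_prob_def ex)
        show "card {i \<in> {N..<N + M}. exceeds k (vals \<omega> {..<N}) (U (\<omega> i))} \<le> l"
          using that(2) by (simp add: G_def J J0_def ex)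
      qed (use elim in \<open>auto simp: A_def\<close>)
      ultimately show ?thesis by blast
    qed
    have "(\<Sum>I\<in>F. \<Sum>J\<in>G. indicator (R I J) \<omega>)
        \<le> (\<Sum>I\<in>F. \<Sum>J\<in>G. if I = I0 \<and> J = J0 then indicator B \<omega> else 0 :: real)"
    proof (intro sum_mono)
      fix I J assume FG: "I \<in> F" "J \<in> G"
      show "indicator (R I J) \<omega> \<le> (if I = I0 \<and> J = J0 then indicator B \<omega> else 0 :: real)"
      proof (cases "\<omega> \<in> R I J")
        case True
        from IJ[OF FG this] True show ?thesis by simp
      qed simp
    qed
    also have "\<dots> = (\<Sum>I\<in>F. if I = I0 then (if J0 \<in> G then indicator B \<omega> else 0) else 0 :: real)"
    proof (rule sum.cong)
      fix I assume "I \<in> F"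
      show "(\<Sum>J\<in>G. if I = I0 \<and> J = J0 then indicator B \<omega> else 0 :: real)
          = (if I = I0 then if J0 \<in> G then indicator B \<omega> else 0 else 0)"
        using G by (cases "I = I0") simp_all
    qed simp
    also have "\<dots> \<le> indicator B \<omega>"
      using F by (auto split: split_indicator)
    finally show ?case .
  qed
  then have "integral\<^sup>L (Prod A) (\<lambda>\<omega>. \<Sum>I\<in>F. \<Sum>J\<in>G. indicator (R I J) \<omega>) \<le> integral\<^sup>L (Prod A) (indicator B :: _ \<Rightarrow> real)"
    using B[folded A_def]
    by (intro integral_mono_AE Bochner_Integration.integrable_sum int)
      (auto intro!: integrable_real_indicator simp: PP.emeasure_eq_measure)
  also have "integral\<^sup>L (Prod A) (indicator B :: _ \<Rightarrow> real) = measure (Prod A) B"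
    using B by (simp add: A_def)
  also have "integral\<^sup>L (Prod A) (\<lambda>\<omega>. \<Sum>I\<in>F. \<Sum>J\<in>G. indicator (R I J) \<omega> :: real)
      = (\<Sum>I\<in>F. \<Sum>J\<in>G. measure (Prod A) (R I J))"
  proof -
    have "integral\<^sup>L (Prod A) (\<lambda>\<omega>. \<Sum>I\<in>F. \<Sum>J\<in>G. indicator (R I J) \<omega> :: real)
        = (\<Sum>I\<in>F. integral\<^sup>L (Prod A) (\<lambda>\<omega>. \<Sum>J\<in>G. indicator (R I J) \<omega> :: real))"
      by (intro Bochner_Integration.integral_sum Bochner_Integration.integrable_sum int)
    also have "\<dots> = (\<Sum>I\<in>F. \<Sum>J\<in>G. integral\<^sup>L (Prod A) (\<lambda>\<omega>. indicator (R I J) \<omega> :: real))"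
      by (intro sum.cong refl Bochner_Integration.integral_sum int)
    also have "\<dots> = (\<Sum>I\<in>F. \<Sum>J\<in>G. measure (Prod A) (R I J))"
      using R by (intro sum.cong refl) simp
    finally show ?thesis .
  qed
  also have "\<dots> = real (N choose k) * (\<Sum>J\<in>G. \<psi> (card J))"
    using mR F by simp
  also have "\<dots> = real (N choose k) * (\<Sum>j\<le>l. real (M choose j) * \<psi> j)"
    using sum_subsets_card_le[of "{N..<N + M}" \<psi> l] by (simp add: G_def)
  also have "\<dots> = integral\<^sup>L excess_law (\<lambda>v. indicator {a<..} v *
      (\<Sum>j\<le>l. real (N choose k) * real (M choose j) * (v ^ j * (1 - v) ^ (N + M - k - j))))"
  proof -
    interpret L: prob_space excess_law by (rule prob_space_excess_law)
    have int: "integrable excess_law (\<lambda>v. indicator {a<..} v * (v ^ j * (1 - v) ^ q))" for j q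
    proof (rule L.integrable_const_bound[of _ 1])
      show "(\<lambda>v. indicator {a<..} v * (v ^ j * (1 - v) ^ q)) \<in> borel_measurable excess_law"
        by (subst measurable_cong_sets[OF sets_excess_law refl]) measurable
      show "AE v in excess_law. norm (indicator {a<..} v * (v ^ j * (1 - v) ^ q)) \<le> 1"
        using AE_excess_law
        by eventually_elim (auto simp: abs_mult intro!: mult_le_one power_le_one split: split_indicator)
    qed
    have "integral\<^sup>L excess_law (\<lambda>v. indicator {a<..} v *
      (\<Sum>j\<le>l. real (N choose k) * real (M choose j) * (v ^ j * (1 - v) ^ (N + M - k - j))))
      = integral\<^sup>L excess_law (\<lambda>v. \<Sum>j\<le>l. (real (N choose k) * real (M choose j)) *
          (indicator {a<..} v * (v ^ j * (1 - v) ^ (N + M - k - j))))"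
      by (intro Bochner_Integration.integral_cong) (auto simp: sum_distrib_left algebra_simps)
    also have "\<dots> = (\<Sum>j\<le>l. (real (N choose k) * real (M choose j)) * \<psi> j)"
      unfolding \<psi>_def using int by (subst Bochner_Integration.integral_sum) auto
    finally show ?thesis by (simp add: sum_distrib_left mult.assoc)
  qed
  finally have le: "integral\<^sup>L excess_law (\<lambda>v. indicator {a<..} v *
      (\<Sum>j\<le>l. real (N choose k) * real (M choose j) * (v ^ j * (1 - v) ^ (N + M - k - j))))
      \<le> measure (Prod A) B" .
  show ?thesis
    using truncated_expectation_ge[OF prob_space_excess_law sets_excess_law AE_excess_law k l moments_excess_law c] le
    by (simp add: A_def)
qed

end

section \<open>The selection as a scenario program\<close>

lemma lower_semicontinuous_continuous:
  fixes g :: "'x::t2_space \<Rightarrow> real"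
  assumes "continuous_on UNIV g"
  shows "lower_semicontinuous g"
  unfolding lower_semicontinuous_def
proof (intro allI impI)
  fix x c assume "c < g x"
  moreover have "(g \<longlongrightarrow> g x) (nhds x)"
    using assms by (simp add: continuous_on_eq_continuous_at isCont_def tendsto_at_iff_tendsto_nhds)
  ultimately show "\<forall>\<^sub>F y in nhds x. c < g y" by (rule order_tendstoD(1)[rotated])
qed

lemma borel_measurable_gain: "U \<in> borel_measurable P \<Longrightarrow> (\<lambda>\<delta>. gain e j (U \<delta>)) \<in> borel_measurable P"
  by (induction j) auto

locale picking_program = atomless_scenarios P U k
  for P :: "'s measure" and U k +
  fixes \<pi> :: "nat \<Rightarrow> 'n::finite"
  assumes inj: "inj_on \<pi> {..<k}"
begin

definition constr :: "real ^ 'n \<Rightarrow> 's \<Rightarrow> real" where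
  "constr x \<delta> = prog_constr k \<pi> x (U \<delta>)"

abbreviation "Dom \<equiv> prog_dom k \<pi>"

lemma feasible_eq:
  "feasible Dom constr \<omega> I = prog_feasible k \<pi> (vals \<omega> I)"
  by (auto simp: feasible_def prog_feasible_def constr_def vals_def fun_eq_iff)

lemma is_arg_min_iff:
  assumes "\<omega> \<in> space (Prod A)" "finite I" "I \<subseteq> A"
  shows "is_arg_min prog_obj (feasible Dom constr \<omega> I) x \<longleftrightarrow> x = opt k \<pi> (vals \<omega> I)"
  unfolding feasible_eq
  using vals_range[OF assms(1,3)] assms(2) by (intro is_arg_min_opt_iff inj) (auto intro: less_imp_le)

lemma solution_eq:
  assumes "\<omega> \<in> space (Prod A)" "finite I" "I \<subseteq> A"
  shows "solution Dom prog_obj constr \<omega> I = opt k \<pi> (vals \<omega> I)"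
  unfolding solution_def arg_min_def is_arg_min_iff[OF assms] by simp

lemma solution_eq_iff:
  assumes "\<omega> \<in> space (Prod A)" "finite I" "I \<subseteq> A" "finite I'" "I' \<subseteq> A"
  shows "solution Dom prog_obj constr \<omega> I = solution Dom prog_obj constr \<omega> I'
     \<longleftrightarrow> (\<forall>j<k. level (vals \<omega> I) j = level (vals \<omega> I') j)"
  using assms by (simp add: solution_eq opt_eq_iff[OF inj])

lemma constr_solution_pos:
  assumes "\<omega> \<in> space (Prod A)" "finite I" "I \<subseteq> A"
  shows "constr (solution Dom prog_obj constr \<omega> I) \<delta> > 0 \<longleftrightarrow> exceeds k (vals \<omega> I) (U \<delta>)"
  unfolding constr_def solution_eq[OF assms] using assms(2) by (simp add: prog_constr_opt[OF inj])

lemma violation_prob_solution: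
  assumes "\<omega> \<in> space (Prod A)" "finite I" "I \<subseteq> A"
  shows "violation_prob P constr (solution Dom prog_obj constr \<omega> I) = excess_prob (vals \<omega> I)"
  by (simp add: violation_prob_def excess_prob_def constr_solution_pos[OF assms])

lemma support_constraints_eq:
  assumes "\<omega> \<in> space (Prod A)" "{..<m} \<subseteq> A"
  shows "support_constraints Dom prog_obj constr \<omega> m =
    {i \<in> {..<m}. \<exists>j<k. level (vals \<omega> ({..<m} - {i})) j \<noteq> level (vals \<omega> {..<m}) j}"
  unfolding support_constraints_def
  using assms by (subst solution_eq_iff[OF assms(1)]) auto

text \<open>By injectivity, removing an index removes its value; then
  \<open>levels_neq_without_pick\<close> and \<open>levels_picks\<close> give the two
  directions.\<close>

lemma support_constraints_generic:
  assumes \<omega>: "\<omega> \<in> space (Prod A)" "{..<m} \<subseteq> A" and gen: "generic \<omega> {..<m}"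
  shows "support_constraints Dom prog_obj constr \<omega> m = pick_idx \<omega> {..<m}"
proof -
  let ?W = "vals \<omega> {..<m}"
  have inj': "inj_on (\<lambda>i. U (\<omega> i)) {..<m}" and tf: "tie_free ?W" using gen by (auto simp: generic_def)
  have "(\<exists>j<k. level (vals \<omega> ({..<m} - {i})) j \<noteq> level ?W j) \<longleftrightarrow> U (\<omega> i) \<in> picks k ?W" if i: "i < m" for i
  proof -
    have W': "vals \<omega> ({..<m} - {i}) = ?W - {U (\<omega> i)}"
      unfolding vals_def using inj_on_image_set_diff[OF inj', of "{..<m}" "{i}"] i by auto
    show ?thesis
    proof
      assume "U (\<omega> i) \<in> picks k ?W"
      then show "\<exists>j<k. level (vals \<omega> ({..<m} - {i})) j \<noteq> level ?W j"
        unfolding W' by (intro levels_neq_without_pick tf) auto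
    next
      assume neq: "\<exists>j<k. level (vals \<omega> ({..<m} - {i})) j \<noteq> level ?W j"
      show "U (\<omega> i) \<in> picks k ?W"
      proof (rule ccontr)
        assume "U (\<omega> i) \<notin> picks k ?W"
        then have "picks k ?W \<subseteq> ?W - {U (\<omega> i)}" using picks_subset[of k ?W] by blast
        with neq show False unfolding W' using levels_picks[of ?W k "?W - {U (\<omega> i)}"] by auto
      qed
    qed
  qed
  then show ?thesis unfolding support_constraints_eq[OF \<omega>] pick_idx_def by auto
qed

text \<open>The class demands the bound for every multi-scenario, so ties cannot be excluded here.
  One maximizing index is fixed per stage of positive level; removing any other index keeps these
  maximizers and hence all levels. At stages of level \<open>0\<close> the value of \<open>p\<close>
  is arbitrary.\<close>

lemma card_support_constraints_le:
  assumes \<omega>: "\<omega> \<in> space (Prod {..<m})"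
  shows "card (support_constraints Dom prog_obj constr \<omega> m) \<le> k"
proof -
  let ?W = "vals \<omega> {..<m}"
  have "\<exists>i. 0 < level ?W j \<longrightarrow> i < m \<and> score ?W j (U (\<omega> i)) = level ?W j" for j
    using level_attained[of ?W j] by (auto simp: vals_def)
  then obtain p where p: "\<And>j. 0 < level ?W j \<Longrightarrow> p j < m \<and> score ?W j (U (\<omega> (p j))) = level ?W j"
    by metis
  have "i \<in> p ` {..<k}" if i: "i \<in> support_constraints Dom prog_obj constr \<omega> m" for i
  proof (rule ccontr)
    assume np: "i \<notin> p ` {..<k}"
    have "level (vals \<omega> ({..<m} - {i})) j = level ?W j" if "j < k" for j
    proof (rule levels_eq_subset[OF _ _ _ that])
      fix j assume j: "j < k" "0 < level ?W j"
      have "p j \<in> {..<m} - {i}" using p[OF j(2)] np j(1) by auto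
      then show "\<exists>u\<in>vals \<omega> ({..<m} - {i}). score ?W j u = level ?W j"
        using p[OF j(2)] unfolding vals_def by blast
    qed (auto simp: vals_def)
    with i show False unfolding support_constraints_eq[OF \<omega> order_refl] by auto
  qed
  then have "support_constraints Dom prog_obj constr \<omega> m \<subseteq> p ` {..<k}" by blast
  then have "card (support_constraints Dom prog_obj constr \<omega> m) \<le> card (p ` {..<k})"
    by (intro card_mono) auto
  also have "\<dots> \<le> k" using card_image_le[of "{..<k}" p] by simp
  finally show ?thesis .
qed

lemma scenario_program:
  assumes "k \<le> \<zeta>"
  shows "scenario_program P Dom prog_obj constr \<zeta>"
proof
  show "convex Dom" "closed Dom" "convex_on UNIV prog_obj"
    by (rule convex_prog_dom closed_prog_dom convex_prog_obj)+
  show "convex_on UNIV (\<lambda>x. constr x \<delta>)" "lower_semicontinuous (\<lambda>x. constr x \<delta>)" if "\<delta> \<in> space P" for \<delta>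
    unfolding constr_def using U_range[OF that]
    by (auto intro!: convex_prog_constr lower_semicontinuous_continuous continuous_prog_constr)
  show "constr x \<in> borel_measurable P" for x
    unfolding constr_def[abs_def] prog_constr_def
    by (intro borel_measurable_sum borel_measurable_max borel_measurable_diff borel_measurable_times
        borel_measurable_add borel_measurable_gain) auto
  show "\<exists>!x. is_arg_min prog_obj (feasible Dom constr \<omega> {..<m}) x" if "\<omega> \<in> space (Prod {..<m})" for m \<omega>
    using is_arg_min_iff[OF that] by simp
  show "(\<lambda>\<omega>. violation_prob P constr (solution Dom prog_obj constr \<omega> {..<m})) \<in> borel_measurable (Prod {..<m})" for m
    using excess_prob_measurable[of "{..<m}" "{..<m}"]
    by (subst measurable_cong[OF violation_prob_solution]) auto
  show "AE \<omega> in Prod {..<m}. solution Dom prog_obj constr \<omega> {..<m}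
      = solution Dom prog_obj constr \<omega> (support_constraints Dom prog_obj constr \<omega> m)" for m
    using AE_generic[OF finite_lessThan order_refl] AE_space
  proof eventually_elim
    case (elim \<omega>)
    have sub: "pick_idx \<omega> {..<m} \<subseteq> {..<m}" by (auto simp: pick_idx_def)
    have "level (vals \<omega> {..<m}) j = level (vals \<omega> (pick_idx \<omega> {..<m})) j" if "j < k" for j
      unfolding vals_pick_idx by (rule levels_picks[symmetric]) (auto simp: that picks_subset)
    then show ?case
      unfolding support_constraints_generic[OF elim(2) order_refl elim(1)]
      using sub finite_subset[OF sub] by (subst solution_eq_iff[OF elim(2)]) auto
  qed
  show "card (support_constraints Dom prog_obj constr \<omega> m) \<le> \<zeta>" if "\<omega> \<in> space (Prod {..<m})" for m \<omega>
    using card_support_constraints_le[OF that] assms by simp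
qed

lemma validation_violations_eq:
  assumes \<omega>: "\<omega> \<in> space (Prod {..<N + M})"
  shows "validation_violations Dom prog_obj constr N M \<omega>
    = card {i \<in> {N..<N + M}. exceeds k (vals \<omega> {..<N}) (U (\<omega> i))}"
proof -
  let ?Q = "\<lambda>i. exceeds k (vals \<omega> {..<N}) (U (\<omega> i))"
  have "validation_violations Dom prog_obj constr N M \<omega> = (\<Sum>i<M. if ?Q (N + i) then 1 else 0)"
    unfolding validation_violations_def
    by (intro sum.cong) (auto simp: indicator_def constr_solution_pos[OF \<omega>])
  also have "\<dots> = (\<Sum>i\<in>{N..<N + M}. if ?Q i then 1 else 0)"
    by (rule sum.reindex_bij_witness[of _ "\<lambda>i. i - N" "\<lambda>i. N + i"]) auto
  also have "\<dots> = card {i \<in> {N..<N + M}. ?Q i}"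
    by (simp add: sum.If_cases Int_def conj_commute)
  finally show ?thesis .
qed

section \<open>The event bounded by the guarantee, and the resulting lower limit\<close>

definition bad_event :: "(nat \<Rightarrow> nat \<Rightarrow> real) \<Rightarrow> nat \<Rightarrow> nat \<Rightarrow> (nat \<Rightarrow> 's) set" where
  "bad_event \<epsilon> N M = {\<omega> \<in> space (Prod {..<N + M}).
     violation_prob P constr (solution Dom prog_obj constr \<omega> {..<N})
       > \<epsilon> (card (support_constraints Dom prog_obj constr \<omega> N)) (validation_violations Dom prog_obj constr N M \<omega>)}"

text \<open>As \<open>\<epsilon>\<close> is arbitrary, the event is split by the finitely many
  support sets \<open>T\<close> and sets \<open>J\<close> of violated validation scenarios; on each
  piece the threshold is constant.\<close>

lemma sets_bad_event: "bad_event \<epsilon> N M \<in> sets (Prod {..<N + M})"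
proof -
  let ?A = "{..<N + M}"
  let ?S = "\<lambda>\<omega> i. \<exists>j\<in>{..<k}. level (vals \<omega> ({..<N} - {i})) j \<noteq> level (vals \<omega> {..<N}) j"
  let ?Q = "\<lambda>\<omega> i. exceeds k (vals \<omega> {..<N}) (U (\<omega> i))"
  have lev: "(\<lambda>\<omega>. level (vals \<omega> I) j) \<in> borel_measurable (Prod ?A)" if "I \<subseteq> {..<N}" for I j
    unfolding vals_def using that finite_subset[OF that]
    by (intro borel_measurable_level U_component) auto
  have S: "Measurable.pred (Prod ?A) (\<lambda>\<omega>. ?S \<omega> i)" for i
  proof -
    have "Measurable.pred (Prod ?A) (\<lambda>\<omega>. level (vals \<omega> ({..<N} - {i})) j = level (vals \<omega> {..<N}) j)" for j
      using borel_measurable_eq[OF lev lev, of "{..<N} - {i}" "{..<N}"] by (auto simp: pred_def)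
    then show ?thesis by (intro pred_intros_finite pred_intros_logic) auto
  qed
  have Q: "Measurable.pred (Prod ?A) (\<lambda>\<omega>. ?Q \<omega> i)" if "i \<in> {N..<N + M}" for i
    using that by (intro pred_exceeds_vals) auto
  have E: "Measurable.pred (Prod ?A) (\<lambda>\<omega>. c < excess_prob (vals \<omega> {..<N}))" for c
    using excess_prob_measurable[of "{..<N}" ?A] by simp
  have "bad_event \<epsilon> N M = {\<omega> \<in> space (Prod ?A). \<exists>T\<in>Pow {..<N}. \<exists>J\<in>Pow {N..<N + M}.
      (\<forall>i\<in>{..<N}. ?S \<omega> i \<longleftrightarrow> i \<in> T) \<and> (\<forall>i\<in>{N..<N + M}. ?Q \<omega> i \<longleftrightarrow> i \<in> J)
      \<and> \<epsilon> (card T) (card J) < excess_prob (vals \<omega> {..<N})}"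
    (is "_ = ?E")
  proof (intro set_eqI)
    fix \<omega>
    show "\<omega> \<in> bad_event \<epsilon> N M \<longleftrightarrow> \<omega> \<in> ?E"
    proof (cases "\<omega> \<in> space (Prod ?A)")
      case True
      define T0 where "T0 = {i \<in> {..<N}. ?S \<omega> i}"
      define J0 where "J0 = {i \<in> {N..<N + M}. ?Q \<omega> i}"
      have "\<omega> \<in> bad_event \<epsilon> N M \<longleftrightarrow> \<epsilon> (card T0) (card J0) < excess_prob (vals \<omega> {..<N})"
        using True by (simp add: bad_event_def violation_prob_solution[OF True]
          support_constraints_eq[OF True] validation_violations_eq[OF True] T0_def J0_def Bex_def)
      also have "\<dots> \<longleftrightarrow> (\<exists>T\<in>Pow {..<N}. \<exists>J\<in>Pow {N..<N + M}. T = T0 \<and> J = J0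
          \<and> \<epsilon> (card T) (card J) < excess_prob (vals \<omega> {..<N}))"
        unfolding T0_def J0_def by blast
      also have "\<dots> \<longleftrightarrow> \<omega> \<in> ?E"
      proof -
        have T: "T = T0 \<longleftrightarrow> (\<forall>i\<in>{..<N}. ?S \<omega> i \<longleftrightarrow> i \<in> T)" if "T \<in> Pow {..<N}" for T
          using that unfolding T0_def by blast
        have J: "J = J0 \<longleftrightarrow> (\<forall>i\<in>{N..<N + M}. ?Q \<omega> i \<longleftrightarrow> i \<in> J)" if "J \<in> Pow {N..<N + M}" for J
          using that unfolding J0_def by blast
        have "(\<exists>T\<in>Pow {..<N}. \<exists>J\<in>Pow {N..<N + M}. T = T0 \<and> J = J0
            \<and> \<epsilon> (card T) (card J) < excess_prob (vals \<omega> {..<N}))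
          \<longleftrightarrow> (\<exists>T\<in>Pow {..<N}. \<exists>J\<in>Pow {N..<N + M}.
            (\<forall>i\<in>{..<N}. ?S \<omega> i \<longleftrightarrow> i \<in> T) \<and> (\<forall>i\<in>{N..<N + M}. ?Q \<omega> i \<longleftrightarrow> i \<in> J)
            \<and> \<epsilon> (card T) (card J) < excess_prob (vals \<omega> {..<N}))"
          by (intro bex_cong refl) (simp only: T J)
        then show ?thesis using True by (simp only: mem_Collect_eq simp_thms)
      qed
      finally show ?thesis .
    qed (simp add: bad_event_def)
  qed
  moreover have "Measurable.pred (Prod ?A) (\<lambda>\<omega>. \<exists>T\<in>Pow {..<N}. \<exists>J\<in>Pow {N..<N + M}.
      (\<forall>i\<in>{..<N}. ?S \<omega> i \<longleftrightarrow> i \<in> T) \<and> (\<forall>i\<in>{N..<N + M}. ?Q \<omega> i \<longleftrightarrow> i \<in> J)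
      \<and> \<epsilon> (card T) (card J) < excess_prob (vals \<omega> {..<N}))"
    by (intro pred_intros_finite pred_intros_logic S Q E) auto
  ultimately show ?thesis by (simp add: pred_def)
qed

text \<open>Suppose \<open>\<epsilon> k l < e\<close>. By monotonicity of \<open>\<epsilon>\<close>
  in its second argument, \<open>bad_event\<close> almost surely occurs whenever the violation
  probability exceeds \<open>\<epsilon> k l\<close> with at most \<open>l\<close> validation
  scenarios violated. This alone has probability above \<open>\<beta>\<close>.\<close>

lemma admissible_ge_root:
  assumes adm: "admissible TYPE('n) TYPE('s) \<zeta> N M \<beta> \<epsilon>"
    and k: "1 \<le> k" "k \<le> \<zeta>" "\<zeta> < N" and l: "l \<le> M" and root: "is_limit_root N M \<beta> k l e"
  shows "e \<le> \<epsilon> k l"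
proof (rule ccontr)
  assume "\<not> e \<le> \<epsilon> k l"
  then have lt: "\<epsilon> k l < e" by simp
  have "\<epsilon> k l \<in> {0..1}" using adm k l unfolding admissible_def by auto
  then have eps0: "0 \<le> \<epsilon> k l" by simp
  have step: "\<epsilon> k i < \<epsilon> k (Suc i)" if "i < M" for i
    using adm k that unfolding admissible_def by auto
  have mono: "\<epsilon> k r \<le> \<epsilon> k l" if "r \<le> l" for r
    using that l
  proof (induction l rule: dec_induct)
    case (step n)
    then show ?case using \<open>\<And>i. i < M \<Longrightarrow> \<epsilon> k i < \<epsilon> k (Suc i)\<close>[of n] by simp
  qed simp
  have e: "0 < e" "e < 1" "(\<Sum>j = 0..l. zcoef N M k j * binom_tail (N + M) e (k + j - 1)) = \<beta>"
    using root by (auto simp: is_limit_root_def)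
  \<comment> \<open>\<open>prob_excess_ge\<close> gives its bound only at points above the
    threshold; a point still below \<open>e\<close> makes the sum exceed \<open>\<beta>\<close> by
    strict decrease.\<close>
  define c where "c = (\<epsilon> k l + e) / 2"
  have c: "\<epsilon> k l < c" "c < e" using lt by (auto simp: c_def)
  have "measure (Prod {..<N + M}) (bad_event \<epsilon> N M) \<le> \<beta>"
    using adm scenario_program[OF k(2)] unfolding admissible_def bad_event_def by blast
  moreover have "(\<Sum>j = 0..l. zcoef N M k j * binom_tail (N + M) c (k + j - 1))
      \<le> measure (Prod {..<N + M}) (bad_event \<epsilon> N M)"
  proof (rule prob_excess_ge[OF k(1) _ l eps0 c(1) _ sets_bad_event])
    fix \<omega> assume \<omega>: "\<omega> \<in> space (Prod {..<N + M})" and gen: "generic \<omega> {..<N}"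
      and V: "\<epsilon> k l < excess_prob (vals \<omega> {..<N})"
      and r: "card {i \<in> {N..<N + M}. exceeds k (vals \<omega> {..<N}) (U (\<omega> i))} \<le> l"
    have "card (support_constraints Dom prog_obj constr \<omega> N) = k"
      using card_pick_idx[OF \<omega> _ _ _ gen] k support_constraints_generic[OF \<omega> _ gen] by simp
    moreover have "violation_prob P constr (solution Dom prog_obj constr \<omega> {..<N}) = excess_prob (vals \<omega> {..<N})"
      by (rule violation_prob_solution[OF \<omega>]) auto
    ultimately show "\<omega> \<in> bad_event \<epsilon> N M"
      using \<omega> V mono[OF r] by (simp add: bad_event_def validation_violations_eq)
  qed (use k e c in auto)
  moreover have "\<beta> < (\<Sum>j = 0..l. zcoef N M k j * binom_tail (N + M) c (k + j - 1))"
    using limit_sum_strict_antimono[of k N l M c e] k l c e eps0 by simp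
  ultimately show False by simp
qed

end

text \<open>The uniform law is pushed forward along an embedding of the reals into the scenario
  type.\<close>

lemma exists_atomless_scenarios:
  assumes "(UNIV :: real set) \<lesssim> (UNIV :: 's set)"
  shows "\<exists>(P :: 's measure) U. atomless_scenarios P U"
proof -
  obtain g :: "real \<Rightarrow> 's" where g: "inj g" using assms unfolding lepoll_def by auto
  define Q :: "real measure" where "Q = uniform_measure lborel {0..1}"
  \<comment> \<open>Pulling the sigma-algebra back along \<open>inv g\<close> makes both
    \<open>g\<close> and \<open>inv g\<close> measurable.\<close>
  define P where "P = distr Q (vimage_algebra UNIV (inv g) borel) g"
  \<comment> \<open>The logistic form puts \<open>U\<close> into the open unit interval at every
    scenario, including those outside the range of \<open>g\<close>; its injectivity on the range
    keeps the law atomless.\<close>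
  define U where "U \<delta> = 1 / (1 + exp (inv g \<delta>))" for \<delta>
  interpret Q: prob_space Q unfolding Q_def by (rule prob_space_uniform_measure) auto
  have sQ: "sets Q = sets borel" "space Q = UNIV" by (simp_all add: Q_def)
  have gm: "g \<in> Q \<rightarrow>\<^sub>M vimage_algebra UNIV (inv g) borel"
    using g by (intro measurable_vimage_algebra2) (auto simp: measurable_cong_sets[OF sQ(1) refl])
  have inv: "inv g \<in> borel_measurable (vimage_algebra UNIV (inv g) borel)"
    by (rule measurable_vimage_algebra1) auto
  have Um: "U \<in> borel_measurable P"
    unfolding P_def U_def[abs_def] using inv by simp
  have "atomless_scenarios P U"
  proof (intro atomless_scenarios.intro atomless_scenarios_axioms.intro)
    show "prob_space P" unfolding P_def by (rule Q.prob_space_distr[OF gm])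
    show "U \<in> borel_measurable P" by fact
    show "0 < U \<delta> \<and> U \<delta> < 1" for \<delta>
      by (simp add: U_def add_pos_pos field_simps)
    show "AE \<delta> in P. U \<delta> \<noteq> c" for c
    proof -
      have "AE x in Q. U (g x) \<noteq> c"
      proof (cases "\<exists>x. U (g x) = c")
        case False
        then show ?thesis by simp
      next
        case True
        then obtain x0 where x0: "U (g x0) = c" by blast
        have "x = x0" if "U (g x) = c" for x
        proof -
          have "1 / (1 + exp x) = 1 / (1 + exp x0)" using that x0 g by (simp add: U_def)
          moreover have "1 + exp x \<noteq> 0" "1 + exp x0 \<noteq> 0" using exp_gt_zero[of x] exp_gt_zero[of x0] by linarith+
          ultimately show ?thesis by (simp add: field_simps)
        qed
        moreover have "AE x in Q. x \<noteq> x0"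
          unfolding Q_def using AE_lborel_singleton[of x0] by (intro AE_uniform_measureI) auto
        ultimately show ?thesis by (auto elim: eventually_mono)
      qed
      moreover have "{\<delta> \<in> space (vimage_algebra UNIV (inv g) borel). U \<delta> \<noteq> c} \<in> sets (vimage_algebra UNIV (inv g) borel)"
      proof -
        note [measurable] = Um
        have "Measurable.pred P (\<lambda>\<delta>. U \<delta> \<noteq> c)" by measurable
        then show ?thesis by (simp add: pred_def P_def)
      qed
      ultimately show ?thesis unfolding P_def by (subst AE_distr_iff[OF gm])
    qed
  qed
  then show ?thesis by blast
qed

theorem theorem7:
  fixes \<zeta> N M :: nat and \<beta> :: real
  assumes "(UNIV :: real set) \<lesssim> (UNIV :: 's set)"
    and "\<zeta> \<le> CARD('n::finite)"
    and "\<zeta> < N"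
    and "0 < M"
    and "0 < \<beta>" and "\<beta> < 1"
  shows "(\<forall>k\<in>{1..\<zeta>}. \<forall>l\<in>{0..M}.
            ((\<exists>e. is_limit_root N M \<beta> k l e) \<longleftrightarrow> \<beta> < (\<Sum>j = 0..l. zcoef N M k j)) \<and>
            (\<exists>\<^sub>\<le>\<^sub>1 e. is_limit_root N M \<beta> k l e) \<and>
            (\<forall>e. is_limit_root N M \<beta> k l e \<longrightarrow>
               is_lower_limit TYPE('n) TYPE('s) \<zeta> N M \<beta> k l e)) \<and>
         (\<forall>l\<in>{0..M}. is_lower_limit TYPE('n) TYPE('s) \<zeta> N M \<beta> 0 l 0)"
proof (intro conjI ballI)
  fix k l assume kl: "k \<in> {1..\<zeta>}" "l \<in> {0..M}"
  then have k: "1 \<le> k" "k < N" "l \<le> M" using assms(3) by auto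
  show "(\<exists>e. is_limit_root N M \<beta> k l e) \<longleftrightarrow> \<beta> < (\<Sum>j = 0..l. zcoef N M k j)"
    by (rule limit_root_exists_iff[OF k assms(5)])
  show "\<exists>\<^sub>\<le>\<^sub>1 e. is_limit_root N M \<beta> k l e"
    using limit_root_unique[OF k] unfolding Uniq_def by blast
  obtain P :: "'s measure" and U where "atomless_scenarios P U"
    using exists_atomless_scenarios[OF assms(1)] by blast
  \<comment> \<open>The \<open>k\<close> stages need \<open>k\<close> distinct coordinates, which
    \<open>k \<le> \<zeta>\<close> and the bound on \<open>\<zeta>\<close> by the dimension
    provide.\<close>
  moreover obtain \<pi> :: "nat \<Rightarrow> 'n" where "inj_on \<pi> {..<k}"
    using card_le_inj[of "{..<k}" "UNIV :: 'n set"] kl assms(2) by auto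
  ultimately interpret picking_program P U k \<pi>
    by (intro picking_program.intro picking_program_axioms.intro)
  show "\<forall>e. is_limit_root N M \<beta> k l e \<longrightarrow> is_lower_limit TYPE('n) TYPE('s) \<zeta> N M \<beta> k l e"
    unfolding is_lower_limit_def using admissible_ge_root kl assms(3) by auto
next
  fix l assume "l \<in> {0..M}"
  \<comment> \<open>For \<open>k = 0\<close> the range condition in \<open>admissible\<close>
    already gives the bound.\<close>
  then show "is_lower_limit TYPE('n) TYPE('s) \<zeta> N M \<beta> 0 l 0"
    unfolding is_lower_limit_def admissible_def by auto
qed

end
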